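(* Let $\Omega\subset\mathbb{R}^2$ be a simply-connected bounded Lipschitz domain and let $f:D\to\Omega$ be a univalent (injective holomorphic) bi-Lipschitz homeomorphism, where $D=\{z\in\mathbb{C}: |z|<1\}$, with $$f(z)=\sum_{n=0}^\infty a_nz^n,\qquad a_1\in\mathbb{R}.$$ Let $\lambda_1(\Omega)$ be the first eigenvalue of $$-\Delta u=\lambda u\ \text{in }\Omega,\quad u=0\ \text{on }\gamma_0,\quad \frac{\partial u}{\partial\nu}=0\ \text{on }\gamma_1,$$ and $\lambda_1(D)$ the first eigenvalue of $$-\Delta u=\lambda u\ \text{in }D,\quad u=0\ \text{on }\gamma_0',\quad \frac{\partial u}{\partial\nu}=0\ \text{on }\gamma_1',$$ where $\gamma_i=f(\gamma_i')$, $i=0,1$. Let $\hat\phi_1$ be the first eigenfunction of the problem on $\Omega$ with $\int_\Omega\hat\phi_1^2\,dx=1$, and put $\tilde\phi_1=\hat\phi_1\circ f$. Then $$\lambda_1(\Omega)\ \ge\ \lambda_1(D)\left(2\int_D\tilde\phi_1^2\,\mathrm{Re}\,f'(z)\,dx-1\right).$$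
   Context: $\mathbb{R}^2$ is identified with $\mathbb{C}$, and $dx$ is Lebesgue area measure. The map $f$ is extended to a homeomorphism $\overline D\to\overline\Omega$, which gives meaning to $\gamma_i=f(\gamma_i')$. The sets $\gamma_0,\gamma_1$ are disjoint relatively open subsets of $\partial\Omega$ with $\overline{\gamma_0}\cup\overline{\gamma_1}=\partial\Omega$; their closures are allowed to intersect. The eigenvalue problems are understood weakly. Let $V$ be the closure in $H^1(\Omega)$ of $V_0$, the set of functions $v$ on $\Omega$ admitting a smooth extension $\tilde v$ to a neighbourhood of $\overline\Omega$ with $\tilde v|_{\gamma_0}=0$. The problem on $\Omega$ is: $u\in V$, $\int_\Omega u^2\,dx=1$, $\int_\Omega\nabla u\cdot\nabla v\,dx=\lambda\int_\Omega uv\,dx$ for all $v\in V$. The problem on $D$ is the same with $\Omega$ replaced by $D$ and $V$ replaced by $V_D=\{v\circ f: v\in V\}\subset H^1(D)$. The first eigenvalue is the smallest one, i.e. the minimum of $\int|\nabla v|^2/\int v^2$ over nonzero $v$ in the respective space. *)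

theory Defs
  imports "HOL-Analysis.Analysis"
begin

unbundle lipschitz_syntax

text \<open>A Lipschitz domain in the plane: near each boundary point \<open>p\<close>, in a rectangle with orthonormal
  axes \<open>c\<close>, \<open>c \<i>\<close> centred at \<open>p\<close>, the domain is the strict epigraph of a Lipschitz function.\<close>

definition lipschitz_domain :: "complex set \<Rightarrow> bool" where
  "lipschitz_domain S \<longleftrightarrow> open S \<and> connected S \<and> S \<noteq> {} \<and>
    (\<forall>p\<in>frontier S. \<exists>c r h L. \<exists>g :: real \<Rightarrow> real.
        norm c = 1 \<and> 0 < r \<and> 0 < h \<and> L-lipschitz_on {-r<..<r} g \<and>
        (\<forall>s t. \<bar>s\<bar> < r \<longrightarrow> \<bar>t\<bar> < h \<longrightarrow> (p + c * Complex s t \<in> S \<longleftrightarrow> g s < t)))"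

definition bilipschitz_on :: "'a::metric_space set \<Rightarrow> ('a \<Rightarrow> 'b::metric_space) \<Rightarrow> bool" where
  "bilipschitz_on S f \<longleftrightarrow> inj_on f S \<and>
    (\<exists>L. L-lipschitz_on S f) \<and> (\<exists>M. M-lipschitz_on (f ` S) (inv_into S f))"

text \<open>Continuous differentiability of order \<open>n\<close> on an open set \<open>S\<close>.\<close>

fun Ck_on :: "nat \<Rightarrow> 'a::euclidean_space set \<Rightarrow> ('a \<Rightarrow> real) \<Rightarrow> bool" where
  "Ck_on 0 S f \<longleftrightarrow> continuous_on S f"
| "Ck_on (Suc n) S f \<longleftrightarrow> (\<forall>x\<in>S. f differentiable (at x)) \<and>
     (\<forall>b. Ck_on n S (\<lambda>x. frechet_derivative f (at x) b))"

definition smooth_on :: "'a::euclidean_space set \<Rightarrow> ('a \<Rightarrow> real) \<Rightarrow> bool" where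
  "smooth_on S f \<longleftrightarrow> (\<forall>n. Ck_on n S f)"

definition test_function :: "'a::euclidean_space set \<Rightarrow> ('a \<Rightarrow> real) \<Rightarrow> bool" where
  "test_function S \<phi> \<longleftrightarrow> smooth_on UNIV \<phi> \<and>
     compact (closure {x. \<phi> x \<noteq> 0}) \<and> closure {x. \<phi> x \<noteq> 0} \<subseteq> S"

text \<open>Elements of the Lebesgue and Sobolev spaces are represented by functions on the whole space; only
  their values almost everywhere on \<open>S\<close> matter.\<close>

definition square_integrable_on ::
    "'a::euclidean_space set \<Rightarrow> ('a \<Rightarrow> 'b::euclidean_space) \<Rightarrow> bool" where
  "square_integrable_on S u \<longleftrightarrow> u \<in> borel_measurable (lebesgue_on S) \<and>
     integrable (lebesgue_on S) (\<lambda>x. (norm (u x))\<^sup>2)"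

definition has_weak_gradient ::
    "'a::euclidean_space set \<Rightarrow> ('a \<Rightarrow> real) \<Rightarrow> ('a \<Rightarrow> 'a) \<Rightarrow> bool" where
  "has_weak_gradient S u g \<longleftrightarrow> (\<forall>\<phi> b. test_function S \<phi> \<longrightarrow> b \<in> Basis \<longrightarrow>
     (\<integral>x. u x * frechet_derivative \<phi> (at x) b \<partial>lebesgue_on S)
       = - (\<integral>x. (g x \<bullet> b) * \<phi> x \<partial>lebesgue_on S))"

definition H1 :: "'a::euclidean_space set \<Rightarrow> ('a \<Rightarrow> real) set" where
  "H1 S = {u. square_integrable_on S u \<and>
              (\<exists>g. square_integrable_on S g \<and> has_weak_gradient S u g)}"

text \<open>For \<open>u \<in> H1 S\<close> with \<open>S\<close> open, the gradient is determined up to a null subset of \<open>S\<close>, so that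
  none of the integrals below depends on the choice.\<close>

definition weak_grad :: "'a::euclidean_space set \<Rightarrow> ('a \<Rightarrow> real) \<Rightarrow> 'a \<Rightarrow> 'a" where
  "weak_grad S u = (SOME g. square_integrable_on S g \<and> has_weak_gradient S u g)"

definition H1_norm :: "'a::euclidean_space set \<Rightarrow> ('a \<Rightarrow> real) \<Rightarrow> real" where
  "H1_norm S u = sqrt ((\<integral>x. (u x)\<^sup>2 \<partial>lebesgue_on S) +
                       (\<integral>x. (norm (weak_grad S u x))\<^sup>2 \<partial>lebesgue_on S))"

definition H1_closure :: "'a::euclidean_space set \<Rightarrow> ('a \<Rightarrow> real) set \<Rightarrow> ('a \<Rightarrow> real) set" where
  "H1_closure S A = {u \<in> H1 S. \<forall>e>0. \<exists>v \<in> A \<inter> H1 S. H1_norm S (\<lambda>x. u x - v x) < e}"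

text \<open>For bounded \<open>S\<close> the set below is contained in \<open>H1 S\<close>.\<close>

definition smooth_vanishing ::
    "'a::euclidean_space set \<Rightarrow> 'a set \<Rightarrow> ('a \<Rightarrow> real) set" where
  "smooth_vanishing S \<gamma> = {v. \<exists>U w. open U \<and> closure S \<subseteq> U \<and> smooth_on U w \<and>
       (\<forall>x\<in>\<gamma>. w x = 0) \<and> (\<forall>x\<in>S. v x = w x)}"

definition mixed_space ::
    "'a::euclidean_space set \<Rightarrow> 'a set \<Rightarrow> ('a \<Rightarrow> real) set" where
  "mixed_space S \<gamma> = H1_closure S (smooth_vanishing S \<gamma>)"

definition weak_eigenfunction ::
    "'a::euclidean_space set \<Rightarrow> ('a \<Rightarrow> real) set \<Rightarrow> real \<Rightarrow> ('a \<Rightarrow> real) \<Rightarrow> bool" where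
  "weak_eigenfunction S V lam u \<longleftrightarrow> u \<in> V \<and>
     (\<integral>x. (u x)\<^sup>2 \<partial>lebesgue_on S) = 1 \<and>
     (\<forall>v\<in>V. (\<integral>x. weak_grad S u x \<bullet> weak_grad S v x \<partial>lebesgue_on S)
              = lam * (\<integral>x. u x * v x \<partial>lebesgue_on S))"

definition rayleigh :: "'a::euclidean_space set \<Rightarrow> ('a \<Rightarrow> real) \<Rightarrow> real" where
  "rayleigh S v = (\<integral>x. (norm (weak_grad S v x))\<^sup>2 \<partial>lebesgue_on S) /
                  (\<integral>x. (v x)\<^sup>2 \<partial>lebesgue_on S)"

text \<open>An eigenvalue that is a lower bound of the Rayleigh quotient. Since the quotient of an
  eigenfunction is its eigenvalue, this is both the least eigenvalue and the (attained) minimum of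
  the quotient over the nonzero elements of \<open>V\<close>, as the two lemmas record.\<close>

definition is_first_eigenvalue ::
    "'a::euclidean_space set \<Rightarrow> ('a \<Rightarrow> real) set \<Rightarrow> real \<Rightarrow> bool" where
  "is_first_eigenvalue S V lam \<longleftrightarrow> (\<exists>u. weak_eigenfunction S V lam u) \<and>
     (\<forall>v\<in>V. \<not> (AE x in lebesgue_on S. v x = 0) \<longrightarrow> lam \<le> rayleigh S v)"

lemma rayleigh_weak_eigenfunction:
  assumes "weak_eigenfunction S V lam u"
  shows "rayleigh S u = lam"
proof -
  have "(\<integral>x. weak_grad S u x \<bullet> weak_grad S u x \<partial>lebesgue_on S)
          = lam * (\<integral>x. u x * u x \<partial>lebesgue_on S)"
    using assms unfolding weak_eigenfunction_def by blast
  with assms show ?thesis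
    by (simp add: rayleigh_def weak_eigenfunction_def dot_square_norm power2_eq_square)
qed

lemma is_first_eigenvalue_least:
  assumes "is_first_eigenvalue S V lam" and u: "weak_eigenfunction S V \<mu> u"
  shows "lam \<le> \<mu>"
proof -
  have "\<not> (AE x in lebesgue_on S. u x = 0)"
  proof
    assume "AE x in lebesgue_on S. u x = 0"
    then have "AE x in lebesgue_on S. (u x)\<^sup>2 = 0"
      by (auto elim: eventually_mono)
    then have "(\<integral>x. (u x)\<^sup>2 \<partial>lebesgue_on S) = 0"
      by (rule integral_eq_zero_AE)
    with u show False
      by (simp add: weak_eigenfunction_def)
  qed
  with assms have "lam \<le> rayleigh S u"
    by (auto simp: is_first_eigenvalue_def weak_eigenfunction_def)
  with rayleigh_weak_eigenfunction[OF u] show ?thesis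
    by simp
qed

end

theory Submission
  imports Defs "HOL-Complex_Analysis.Conformal_Mappings"
begin

text \<open>The function \<open>\<psi> = \<phi> \<circ> f\<close> is an admissible competitor on the disc, and the Dirichlet integral in two
  dimensions is conformally invariant, so \<open>\<psi>\<close> has the same Dirichlet integral \<open>lam\<Omega>\<close> as \<open>\<phi>\<close>. The
  minimum property of \<open>lamD\<close> therefore gives \<open>lamD * \<integral>\<psi>\<^sup>2 \<le> lam\<Omega>\<close>. What changes under \<open>f\<close> is the \<open>L\<^sup>2\<close>
  norm: the normalisation of \<open>\<phi>\<close> becomes \<open>\<integral>\<psi>\<^sup>2 \<bar>f'\<bar>\<^sup>2 = 1\<close>. Integrating
  \<open>2 * Re f' - \<bar>f'\<bar>\<^sup>2 \<le> 1\<close>, that is \<open>\<bar>f' - 1\<bar>\<^sup>2 \<ge> 0\<close>, against \<open>\<psi>\<^sup>2\<close> bounds \<open>\<integral>\<psi>\<^sup>2\<close> from below by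
  \<open>2 * \<integral>\<psi>\<^sup>2 Re f' - 1\<close>, and the claim follows since \<open>lamD \<ge> 0\<close>. The lower bound on \<open>\<bar>f'\<bar>\<close> coming from
  the Lipschitz inverse ensures that \<open>\<psi>\<^sup>2\<close> is integrable at all.

  Conformal invariance has to be proved for weak gradients, and rests on three results.

  \<^item> The chain rule \<open>has_weak_gradient_holomorphic_pullback\<close>: the pullback of \<open>u\<close> has the weak gradient
    \<open>cnj f' * (g \<circ> f)\<close>. To test it against \<open>\<eta>\<close> in the direction \<open>b\<close>, let \<open>F\<close> be the inverse of \<open>f\<close>. The
    change of variables turns the derivative of \<open>\<eta>\<close> in the direction \<open>b\<close> into the derivative of
    \<open>\<eta> \<circ> F\<close> along the vector field \<open>b * cnj F'\<close>. The Cauchy--Riemann equations for \<open>F'\<close> say that this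
    field is divergence free, so the derivative along it is the divergence of \<open>\<eta> \<circ> F\<close> times the field,
    and the definition of the weak gradient of \<open>u\<close> applies to each component. All the
    smoothness needed is thus on the side of the test functions.
  \<^item> The change of variables \<open>holomorphic_change_of_variables\<close>, obtained from the one on the space of
    real column vectors of length two.
  \<^item> Uniqueness of the weak gradient, without which nothing is known about the gradient selected by
    \<open>weak_grad\<close>. It follows from the fundamental lemma of the calculus of variations, for which it
    suffices to have smooth functions that increase to the indicators of boxes.\<close>

section \<open>Calculus of continuously differentiable functions\<close>

lemma Ck_on_cong:
  assumes "open S" "\<And>x. x \<in> S \<Longrightarrow> f x = g x" "Ck_on n S f"
  shows "Ck_on n S g"
  using assms(2,3)
proof (induction n arbitrary: f g)
  case 0
  then show ?case using continuous_on_cong by fastforce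
next
  case (Suc n)
  have d: "(g has_derivative frechet_derivative f (at x)) (at x)" if "x \<in> S" for x
  proof -
    have "(f has_derivative frechet_derivative f (at x)) (at x)"
      using Suc.prems that frechet_derivative_works by auto
    then show ?thesis
      using has_derivative_transform_within_open[OF _ assms(1) that] Suc.prems(1) by blast
  qed
  have eq: "frechet_derivative g (at x) = frechet_derivative f (at x)" if "x \<in> S" for x
    using frechet_derivative_at[OF d[OF that]] by simp
  have "Ck_on n S (\<lambda>x. frechet_derivative f (at x) b)" for b
    using Suc.prems(2) by simp
  then have "Ck_on n S (\<lambda>x. frechet_derivative g (at x) b)" for b
    by (rule Suc.IH[rotated]) (simp only: eq)
  with d show ?case unfolding Ck_on.simps differentiable_def by blast
qed

text \<open>The definition of \<open>Ck_on\<close> refers to the Frechet derivative as a selected object; this rule allows any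
  formula for the derivative to be used in its place, which makes the inductions below possible.\<close>

lemma Ck_on_SucI:
  assumes "open S" "\<And>x. x \<in> S \<Longrightarrow> (f has_derivative f' x) (at x)" "\<And>b. Ck_on n S (\<lambda>x. f' x b)"
  shows "Ck_on (Suc n) S f"
proof -
  have "Ck_on n S (\<lambda>x. frechet_derivative f (at x) b)" for b
    using frechet_derivative_at[OF assms(2)] by (intro Ck_on_cong[OF assms(1) _ assms(3)[of b]]) simp
  then show ?thesis using assms(2) unfolding Ck_on.simps differentiable_def by blast
qed

lemma Ck_on_SucD: "Ck_on (Suc n) S f \<Longrightarrow> Ck_on n S f"
proof (induction n arbitrary: f)
  case 0
  then show ?case
    by (auto intro!: differentiable_imp_continuous_on simp: differentiable_on_def differentiable_at_withinI)
qed auto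

lemma Ck_on_has_derivative:
  "Ck_on (Suc n) S f \<Longrightarrow> x \<in> S \<Longrightarrow> (f has_derivative frechet_derivative f (at x)) (at x)"
  using frechet_derivative_works by auto

lemma Ck_on_const: "open S \<Longrightarrow> Ck_on n S (\<lambda>x. c)"
proof (induction n arbitrary: c)
  case (Suc n)
  then show ?case by (intro Ck_on_SucI[where f' = "\<lambda>_ _. 0"]) auto
qed auto

lemma Ck_on_add:
  assumes "open S"
  shows "Ck_on n S f \<Longrightarrow> Ck_on n S g \<Longrightarrow> Ck_on n S (\<lambda>x. f x + g x)"
proof (induction n arbitrary: f g)
  case (Suc n)
  show ?case
  proof (rule Ck_on_SucI[OF assms])
    show "((\<lambda>x. f x + g x) has_derivative (\<lambda>b. frechet_derivative f (at x) b + frechet_derivative g (at x) b)) (at x)"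
      if "x \<in> S" for x
      using Suc.prems[THEN Ck_on_has_derivative, OF that] by (rule has_derivative_add)
  qed (use Suc in auto)
qed (auto intro: continuous_intros)

lemma Ck_on_mult:
  assumes "open S"
  shows "Ck_on n S f \<Longrightarrow> Ck_on n S g \<Longrightarrow> Ck_on n S (\<lambda>x. f x * g x)"
proof (induction n arbitrary: f g)
  case (Suc n)
  show ?case
  proof (rule Ck_on_SucI[OF assms])
    show "((\<lambda>x. f x * g x) has_derivative
        (\<lambda>b. f x * frechet_derivative g (at x) b + frechet_derivative f (at x) b * g x)) (at x)"
      if "x \<in> S" for x
      using Suc.prems[THEN Ck_on_has_derivative, OF that] by (rule has_derivative_mult)
    show "Ck_on n S (\<lambda>x. f x * frechet_derivative g (at x) b + frechet_derivative f (at x) b * g x)" for b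
      using Suc.prems[THEN Ck_on_SucD] Suc.prems by (intro Ck_on_add[OF assms] Suc.IH) auto
  qed
qed (auto intro: continuous_intros)

lemma Ck_on_prod:
  assumes "open S" "\<And>i. i \<in> I \<Longrightarrow> Ck_on n S (f i)"
  shows "Ck_on n S (\<lambda>x. \<Prod>i\<in>I. f i x)"
  using assms(2)
  by (induction I rule: infinite_finite_induct) (auto intro: Ck_on_const Ck_on_mult assms(1))

lemma Ck_on_Un:
  assumes "open S" "open T"
  shows "Ck_on n S f \<Longrightarrow> Ck_on n T f \<Longrightarrow> Ck_on n (S \<union> T) f"
  by (induction n arbitrary: f) (auto intro: continuous_on_open_Un assms)

lemma Ck_on_Re_holomorphic:
  assumes "open S" "G holomorphic_on S"
  shows "Ck_on n S (\<lambda>z. Re (G z))"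
  using assms(2)
proof (induction n arbitrary: G)
  case 0
  then show ?case by (auto intro!: continuous_intros holomorphic_on_imp_continuous_on)
next
  case (Suc n)
  show ?case
  proof (rule Ck_on_SucI[OF assms(1)])
    show "((\<lambda>z. Re (G z)) has_derivative (\<lambda>b. Re (deriv G z * b))) (at z)" if "z \<in> S" for z
      using holomorphic_derivI[OF Suc.prems assms(1) that]
      by (intro has_derivative_Re) (simp add: has_field_derivative_def)
    show "Ck_on n S (\<lambda>z. Re (deriv G z * b))" for b
      by (intro Suc.IH holomorphic_intros holomorphic_deriv Suc.prems assms)
  qed
qed

lemma has_derivative_comp_holomorphic:
  assumes "open S" "F holomorphic_on S" "z \<in> S" "(\<eta> has_derivative \<eta>') (at (F z))"
  shows "((\<lambda>z. \<eta> (F z)) has_derivative (\<lambda>b. \<eta>' (deriv F z * b))) (at z)"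
proof -
  have "(F has_derivative (*) (deriv F z)) (at z)"
    using holomorphic_derivI[OF assms(2,1,3)] by (simp add: has_field_derivative_def)
  from has_derivative_compose[OF this assms(4)] show ?thesis .
qed

text \<open>The derivative of \<open>\<eta> \<circ> F\<close> is a combination of the two partial derivatives of \<open>\<eta>\<close>, again composed with
  \<open>F\<close>, whose coefficients are real parts of holomorphic functions. The induction hypothesis, stated for
  all \<open>\<eta>\<close>, applies to the partial derivatives.\<close>

lemma Ck_on_comp_holomorphic:
  fixes \<eta> :: "complex \<Rightarrow> real"
  assumes "open S" "F holomorphic_on S"
  shows "Ck_on n UNIV \<eta> \<Longrightarrow> Ck_on n S (\<lambda>z. \<eta> (F z))"
proof (induction n arbitrary: \<eta>)
  case 0
  then show ?case
    using continuous_on_compose2[of UNIV \<eta> S F] holomorphic_on_imp_continuous_on[OF assms(2)] by auto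
next
  case (Suc n)
  let ?D = "\<lambda>w. frechet_derivative \<eta> (at w)"
  have der: "(\<eta> has_derivative ?D w) (at w)" for w
    using Ck_on_has_derivative[OF Suc.prems] by simp
  \<comment> \<open>The imaginary part is written as a real part, so that one lemma on real parts covers both
    coefficients.\<close>
  have split: "?D w b = Re b * ?D w 1 + Re (-\<i> * b) * ?D w \<i>" for w b
  proof -
    interpret linear "?D w" using der has_derivative_linear by blast
    have "b = Re b *\<^sub>R 1 + Im b *\<^sub>R \<i>" by (simp add: complex_eq_iff)
    then have "?D w b = ?D w (Re b *\<^sub>R 1 + Im b *\<^sub>R \<i>)" by simp
    then show ?thesis by (simp add: add scaleR)
  qed
  show ?case
  proof (rule Ck_on_SucI[OF assms(1)])
    show "((\<lambda>z. \<eta> (F z)) has_derivative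
       (\<lambda>b. Re (deriv F z * b) * ?D (F z) 1 + Re (-\<i> * (deriv F z * b)) * ?D (F z) \<i>)) (at z)" if "z \<in> S" for z
      unfolding split[symmetric] by (rule has_derivative_comp_holomorphic[OF assms that der])
    show "Ck_on n S (\<lambda>z. Re (deriv F z * b) * ?D (F z) 1 + Re (-\<i> * (deriv F z * b)) * ?D (F z) \<i>)" for b
      using Suc.prems
      by (intro Ck_on_add Ck_on_mult Ck_on_Re_holomorphic Suc.IH holomorphic_intros holomorphic_deriv assms) auto
  qed
qed

section \<open>Smooth bump functions supported in boxes\<close>

text \<open>The smooth function that equals \<open>exp (- 1 / t)\<close> for positive \<open>t\<close> and vanishes otherwise is \<open>flat 0\<close>.
  The additional powers of \<open>t\<close> make the family closed under differentiation up to linear combinations,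
  as \<open>flat_has_derivative\<close> shows.\<close>

definition flat :: "nat \<Rightarrow> real \<Rightarrow> real" where
  "flat m t = (if 0 < t then exp (- 1 / t) / t ^ m else 0)"

lemma tendsto_flat_0: "(flat m \<longlongrightarrow> 0) (at 0)"
proof -
  have r: "((\<lambda>x::real. x ^ m / exp x) \<longlongrightarrow> 0) at_top" by (rule tendsto_power_div_exp_0)
  have "((\<lambda>t::real. inverse t ^ m / exp (inverse t)) \<longlongrightarrow> 0) (at_right 0)"
    by (rule filterlim_compose[OF r filterlim_inverse_at_top_right])
  then have "(flat m \<longlongrightarrow> 0) (at_right 0)"
    by (rule Lim_transform_eventually)
       (auto simp: eventually_at_filter flat_def exp_minus field_simps)
  moreover have "(flat m \<longlongrightarrow> 0) (at_left 0)"
    by (rule tendsto_eventually) (auto simp: eventually_at_filter flat_def)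
  ultimately show ?thesis by (simp add: filterlim_split_at)
qed

lemma flat_has_derivative:
  "(flat m has_real_derivative flat (m + 2) t - m * flat (m + 1) t) (at t)"
proof -
  consider "t > 0" | "t < 0" | "t = 0" by linarith
  then show ?thesis
  proof cases
    case 1
    have "((\<lambda>t. exp (- 1 / t) / t ^ m) has_real_derivative flat (m + 2) t - m * flat (m + 1) t) (at t)"
      using 1 
      by (auto intro!: derivative_eq_intros
          simp: flat_def divide_simps power_add power2_eq_square algebra_simps power_eq_if[of t m])
    then show ?thesis
      by (rule has_field_derivative_transform_within_open[where S = "{0<..}"]) (use 1 in \<open>auto simp: flat_def\<close>)
  next
    case 2
    have "((\<lambda>t. 0) has_real_derivative flat (m + 2) t - m * flat (m + 1) t) (at t)"
      using 2 by (auto simp: flat_def)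
    then show ?thesis
      by (rule has_field_derivative_transform_within_open[where S = "{..<0}"]) (use 2 in \<open>auto simp: flat_def\<close>)
  next
    case 3
    \<comment> \<open>At the origin the difference quotient is itself a member of the family.\<close>
    have "(\<lambda>h. (flat m (0 + h) - flat m 0) / h) = flat (m + 1)"
      by (auto simp: flat_def)
    with tendsto_flat_0[of "m+1"] 3 show ?thesis
      by (simp add: DERIV_def flat_def)
  qed
qed

lemma Ck_on_flat_affine: "Ck_on n UNIV (\<lambda>x. flat m (c + x \<bullet> v))"
proof (induction n arbitrary: m)
  case 0
  have "isCont (flat m) t" for t using flat_has_derivative DERIV_isCont by blast
  then have "continuous_on UNIV (flat m)" by (simp add: continuous_at_imp_continuous_on)
  then show ?case 
    unfolding Ck_on.simps by (rule continuous_on_compose2) (auto intro!: continuous_intros)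
next
  case (Suc n)
  show ?case
  proof (rule Ck_on_SucI)
    fix x :: 'a
    show "((\<lambda>x. flat m (c + x \<bullet> v)) has_derivative
      (\<lambda>b. flat (m + 2) (c + x \<bullet> v) * (b \<bullet> v) + (- real m * (b \<bullet> v)) * flat (m + 1) (c + x \<bullet> v))) (at x)"
      by (rule has_derivative_eq_rhs, rule has_derivative_compose[OF _ flat_has_derivative[unfolded has_field_derivative_def]])
         (auto intro!: derivative_eq_intros simp: algebra_simps)
    show "Ck_on n UNIV (\<lambda>x. flat (m + 2) (c + x \<bullet> v) * (b \<bullet> v) + (- real m * (b \<bullet> v)) * flat (m + 1) (c + x \<bullet> v))" for b
      by (intro Ck_on_add Ck_on_mult Ck_on_const Suc.IH open_UNIV)
  qed simp
qed

text \<open>The parameter \<open>k\<close> sharpens the bump: as \<open>flat 0 (k * t)\<close> is the power \<open>1 / k\<close> of \<open>exp (- 1 / t)\<close>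
  for positive \<open>t\<close>, the bump tends to the indicator of the open box as \<open>k\<close> grows, while it stays below 1
  and supported in the same box.\<close>

definition box_bump :: "real \<Rightarrow> 'a::euclidean_space \<Rightarrow> 'a \<Rightarrow> 'a \<Rightarrow> real" where
  "box_bump k a c x = (\<Prod>b\<in>Basis. flat 0 (k * ((x - a) \<bullet> b)) * flat 0 (k * ((c - x) \<bullet> b)))"

lemma Ck_on_box_bump: "Ck_on n UNIV (box_bump k a c)"
proof -
  have 1: "flat 0 (k * ((x - a) \<bullet> b)) = flat 0 (- (k * (a \<bullet> b)) + x \<bullet> (k *\<^sub>R b))" for x b
    by (simp add: algebra_simps)
  have 2: "flat 0 (k * ((c - x) \<bullet> b)) = flat 0 (k * (c \<bullet> b) + x \<bullet> ((- k) *\<^sub>R b))" for x b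
    by (simp add: algebra_simps)
  show ?thesis
    unfolding box_bump_def 1 2
    by (intro Ck_on_prod Ck_on_mult Ck_on_flat_affine open_UNIV)
qed

lemma box_bump_eq_0:
  assumes "0 < k" "x \<notin> box a c"
  shows "box_bump k a c x = 0"
proof -
  obtain b where b: "b \<in> Basis" "\<not> (a \<bullet> b < x \<bullet> b \<and> x \<bullet> b < c \<bullet> b)"
    using assms by (auto simp: mem_box)
  then have "\<not> 0 < k * ((x - a) \<bullet> b) \<or> \<not> 0 < k * ((c - x) \<bullet> b)"
    using assms(1) by (auto simp: inner_diff_left zero_less_mult_iff)
  then have "flat 0 (k * ((x - a) \<bullet> b)) * flat 0 (k * ((c - x) \<bullet> b)) = 0"
    by (auto simp: flat_def)
  with b(1) show ?thesis unfolding box_bump_def by (auto simp: prod_zero_iff)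
qed

lemma test_function_box_bump:
  assumes "0 < k" "cbox a c \<subseteq> S"
  shows "test_function S (box_bump k a c)"
proof -
  have "{x. box_bump k a c x \<noteq> 0} \<subseteq> cbox a c"
    using box_bump_eq_0[OF assms(1)] box_subset_cbox by blast
  then have "closure {x. box_bump k a c x \<noteq> 0} \<subseteq> cbox a c"
    using closed_cbox by (rule closure_minimal)
  moreover from this have "compact (closure {x. box_bump k a c x \<noteq> 0})"
    using bounded_subset[OF bounded_cbox] by (simp add: compact_eq_bounded_closed)
  ultimately show ?thesis
    unfolding test_function_def smooth_on_def using assms Ck_on_box_bump by blast
qed

lemma flat_0_range: "0 \<le> flat 0 t \<and> flat 0 t \<le> 1"
  by (simp add: flat_def)

lemma abs_box_bump_le_1: "\<bar>box_bump k a c x\<bar> \<le> 1"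
proof -
  have "0 \<le> box_bump k a c x" 
    unfolding box_bump_def using flat_0_range by (intro prod_nonneg) auto
  moreover have "box_bump k a c x \<le> 1"
    unfolding box_bump_def using flat_0_range by (intro prod_le_1) (auto intro!: mult_le_one)
  ultimately show ?thesis by simp
qed

lemma tendsto_flat_0_scaled:
  "(\<lambda>k. flat 0 (real (Suc k) * t)) \<longlonglongrightarrow> (if 0 < t then 1 else 0)"
proof (cases "0 < t")
  case True
  have "(\<lambda>k. exp (- (inverse (real (Suc k)) / t))) \<longlonglongrightarrow> exp (- (0 / t))"
    by (intro tendsto_intros LIMSEQ_inverse_real_of_nat) (use True in auto)
  moreover have "exp (- (inverse (real (Suc k)) / t)) = flat 0 (real (Suc k) * t)" for k
    using True unfolding flat_def by (simp add: field_simps zero_less_mult_iff del: of_nat_Suc)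
  ultimately show ?thesis using True by simp
next
  case False
  then have "flat 0 (real (Suc k) * t) = 0" for k
    unfolding flat_def by (simp add: zero_less_mult_iff del: of_nat_Suc)
  with False show ?thesis by simp
qed

lemma tendsto_box_bump:
  "(\<lambda>k. box_bump (real (Suc k)) a c x) \<longlonglongrightarrow> indicator (box a c) x"
proof -
  let ?i = "\<lambda>b. (if 0 < (x - a) \<bullet> b then 1 else 0) * (if 0 < (c - x) \<bullet> b then 1 else (0::real))"
  have "(\<lambda>k. box_bump (real (Suc k)) a c x) \<longlonglongrightarrow> (\<Prod>b\<in>Basis. ?i b)"
    unfolding box_bump_def by (intro tendsto_intros tendsto_flat_0_scaled)
  also have "(\<Prod>b\<in>Basis. ?i b) = indicator (box a c) x"
  proof (cases "x \<in> box a c")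
    case True
    then show ?thesis by (auto simp: mem_box inner_diff_left)
  next
    case False
    then obtain b where "b \<in> Basis" "\<not> (a \<bullet> b < x \<bullet> b \<and> x \<bullet> b < c \<bullet> b)" by (auto simp: mem_box)
    then have "\<exists>b\<in>Basis. ?i b = 0" by (intro bexI[of _ b]) (auto simp: inner_diff_left)
    with False show ?thesis by (auto simp: prod_zero_iff)
  qed
  finally show ?thesis .
qed

lemma test_function_continuous: "test_function S \<phi> \<Longrightarrow> continuous_on UNIV \<phi>"
  unfolding test_function_def smooth_on_def using Ck_on.simps(1) by blast

section \<open>The fundamental lemma of the calculus of variations\<close>

text \<open>Dominated convergence along the bumps of the box, which converge pointwise to its indicator.\<close>

lemma integral_box_eq_0:
  assumes S: "open S" and h: "integrable (lebesgue_on S) h"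
    and ortho: "\<And>\<phi>. test_function S \<phi> \<Longrightarrow> (\<integral>x. h x * \<phi> x \<partial>lebesgue_on S) = (0::real)"
    and sub: "cbox a c \<subseteq> S"
  shows "(\<integral>x\<in>box a c. h x \<partial>lebesgue) = 0"
proof -
  have bS: "box a c \<subseteq> S" using sub box_subset_cbox by blast
  have cont: "box_bump k a c \<in> borel_measurable (lebesgue_on S)" for k
  proof -
    have "continuous_on UNIV (box_bump k a c)"
      using Ck_on_box_bump[of 0 k a c] by simp
    then have "box_bump k a c \<in> borel_measurable lborel"
      by (simp add: borel_measurable_continuous_onI)
    then show ?thesis by (intro measurable_restrict_space1 measurable_completion)
  qed
  have lim: "(\<lambda>k. \<integral>x. h x * box_bump (real (Suc k)) a c x \<partial>lebesgue_on S)
      \<longlonglongrightarrow> (\<integral>x. h x * indicator (box a c) x \<partial>lebesgue_on S)"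
  proof (rule integral_dominated_convergence[where w = "\<lambda>x. \<bar>h x\<bar>"])
    show "AE x in lebesgue_on S. (\<lambda>k. h x * box_bump (real (Suc k)) a c x) \<longlonglongrightarrow> h x * indicator (box a c) x"
      by (intro AE_I2 tendsto_intros tendsto_box_bump)
    show "AE x in lebesgue_on S. norm (h x * box_bump (real (Suc k)) a c x) \<le> \<bar>h x\<bar>" for k
      by (auto simp: abs_mult intro!: mult_left_le abs_box_bump_le_1)
    show "(\<lambda>x. h x * indicator (box a c) x) \<in> borel_measurable (lebesgue_on S)"
      using h bS S by (intro borel_measurable_times borel_measurable_indicator) (auto simp: sets_restrict_space_iff)
  qed (use h cont in \<open>auto intro!: borel_measurable_times\<close>)
  have "(\<integral>x. h x * box_bump (real (Suc k)) a c x \<partial>lebesgue_on S) = 0" for k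
    by (intro ortho test_function_box_bump sub) simp
  with lim have "(\<integral>x. h x * indicator (box a c) x \<partial>lebesgue_on S) = 0"
    by (simp only: LIMSEQ_const_iff)
  also have "(\<integral>x. h x * indicator (box a c) x \<partial>lebesgue_on S) = (\<integral>x\<in>box a c. h x \<partial>lebesgue)"
    using S bS by (subst integral_restrict_space)
      (auto simp: set_lebesgue_integral_def indicator_def intro!: Bochner_Integration.integral_cong)
  finally show ?thesis .
qed

text \<open>The open boxes form an intersection-stable generator of the Borel sets, so by Dynkin's argument
  the integral vanishes over every Borel set; the assumption on the total integral is what the
  complementation step uses. A Lebesgue set differs from a Borel set by a null set.\<close>

lemma AE_zero_if_box_integrals_zero:
  fixes k :: "'a::euclidean_space \<Rightarrow> real"
  assumes k: "integrable lebesgue k" and box: "\<And>a b. (\<integral>x\<in>box a b. k x \<partial>lebesgue) = 0"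
    and total: "(\<integral>x. k x \<partial>lebesgue) = 0"
  shows "AE x in lebesgue. k x = 0"
proof -
  have set_int: "set_integrable lebesgue A k" if "A \<in> sets borel" for A
    unfolding set_integrable_def using that by (intro integrable_mult_indicator k) simp
  have borel: "(\<integral>x\<in>A. k x \<partial>lebesgue) = 0" if "A \<in> sets borel" for A
  proof -
    have "Int_stable (range (\<lambda>(a, b). box a b :: 'a set))"
      by (auto simp: Int_stable_def box_Int_box)
    moreover have "(range (\<lambda>(a, b). box a b :: 'a set)) \<subseteq> Pow UNIV" by auto
    moreover have "A \<in> sigma_sets UNIV (range (\<lambda>(a, b). box a b))"
      using that unfolding borel_eq_box by simp
    ultimately show ?thesis
    proof (induction rule: sigma_sets_induct_disjoint)
      case (basic A)
      then show ?case using box by auto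
    next
      case empty
      then show ?case by (simp add: set_lebesgue_integral_def)
    next
      case (compl A)
      then have A: "A \<in> sets borel" by (simp add: borel_eq_box)
      have "(\<integral>x\<in>A \<union> (UNIV - A). k x \<partial>lebesgue) = (\<integral>x\<in>A. k x \<partial>lebesgue) + (\<integral>x\<in>UNIV - A. k x \<partial>lebesgue)"
        using A by (intro set_integral_Un set_int) auto
      then show ?case using compl.IH total by (simp add: set_lebesgue_integral_def)
    next
      case (union F)
      then have F: "F i \<in> sets borel" for i by (auto simp: borel_eq_box subset_eq)
      have "(\<integral>x\<in>\<Union>(range F). k x \<partial>lebesgue) = (\<Sum>i. (\<integral>x\<in>F i. k x \<partial>lebesgue))"
        using F union(1) by (intro lebesgue_integral_countable_add set_int) (auto simp: disjoint_family_on_def)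
      then show ?case using union.IH by simp
    qed
  qed
  show ?thesis
  proof (rule density_unique_real[of _ k "\<lambda>x. 0"])
    fix A :: "'a set" assume A: "A \<in> sets lebesgue"
    then obtain B N N' where B: "A = B \<union> N" "N \<subseteq> N'" "N' \<in> null_sets lborel" "B \<in> sets lborel"
      by (rule sets_completionE)
    have "AE x in lebesgue. x \<notin> N'"
      using B(3) by (intro AE_completion AE_not_in)
    then have "AE x in lebesgue. x \<in> A \<longleftrightarrow> x \<in> B"
      by eventually_elim (use B in auto)
    moreover have "k \<in> borel_measurable lebesgue" using k by auto
    ultimately have "(\<integral>x\<in>A. k x \<partial>lebesgue) = (\<integral>x\<in>B. k x \<partial>lebesgue)"
      using A B(4) unfolding set_lebesgue_integral_def
      by (intro integral_cong_AE borel_measurable_scaleR borel_measurable_indicator)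
         (auto elim!: eventually_mono simp: indicator_def)
    with borel B(4) show "(\<integral>x\<in>A. k x \<partial>lebesgue) = (\<integral>x\<in>A. 0 \<partial>lebesgue)" by simp
  qed (use k in auto)
qed

text \<open>The function \<open>h\<close> is controlled only inside \<open>S\<close>, while the previous lemma asks for all boxes. It is
  therefore applied to \<open>h\<close> cut off outside a fixed box in \<open>S\<close>, since the intersection with a second box is
  again a box; countably many such boxes cover \<open>S\<close> up to a null set.\<close>

theorem fundamental_lemma_calculus_of_variations:
  assumes S: "open S" and h: "integrable (lebesgue_on S) h"
    and ortho: "\<And>\<phi>. test_function S \<phi> \<Longrightarrow> (\<integral>x. h x * \<phi> x \<partial>lebesgue_on S) = (0::real)"
  shows "AE x in lebesgue_on S. h x = 0"
proof -
  have Sm: "S \<in> sets lebesgue" using S by simp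
  have on_box: "AE x in lebesgue. x \<in> box a c \<longrightarrow> h x = 0" if sub: "cbox a c \<subseteq> S" for a c
  proof -
    have bS: "box a c \<subseteq> S" using sub box_subset_cbox by blast
    let ?k = "\<lambda>x. indicator (box a c) x * h x"
    have "set_integrable lebesgue S h"
      using h Sm by (simp add: set_integrable_def integrable_restrict_space)
    then have "set_integrable lebesgue (box a c) h"
      by (rule set_integrable_subset) (use bS in auto)
    then have k: "integrable lebesgue ?k" by (simp add: set_integrable_def)
    have "(\<integral>x\<in>box p q. ?k x \<partial>lebesgue) = 0" for p q
    proof -
      obtain p' q' where pq: "box p q \<inter> box a c = box p' q'" by (simp add: box_Int_box)
      have "(\<integral>x\<in>box p' q'. h x \<partial>lebesgue) = 0"
      proof (cases "box p' q' = {}")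
        case False
        then have "cbox p' q' \<subseteq> cbox a c"
          using pq subset_box(3)[of p' q' a c] subset_box(1)[of p' q' a c]
          by (metis Int_lower2 closure_box closure_mono box_ne_empty(2) box_eq_empty(1) box_subset_cbox subset_empty)
        with sub show ?thesis using integral_box_eq_0[OF S h ortho] by blast
      qed (simp add: set_lebesgue_integral_def)
      then show ?thesis
        unfolding set_lebesgue_integral_def pq[symmetric] by (simp add: indicator_inter_arith mult.assoc)
    qed
    moreover have "(\<integral>x. ?k x \<partial>lebesgue) = 0"
      using integral_box_eq_0[OF S h ortho sub] by (simp add: set_lebesgue_integral_def)
    ultimately have "AE x in lebesgue. ?k x = 0" by (intro AE_zero_if_box_integrals_zero k)
    then show ?thesis by eventually_elim (auto simp: indicator_def)
  qed
  have on_cbox: "AE x in lebesgue. x \<in> cbox a c \<longrightarrow> h x = 0" if sub: "cbox a c \<subseteq> S" for a c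
  proof -
    have "AE x in lebesgue. x \<notin> cbox a c - box a c"
      by (intro AE_completion AE_not_in cbox_borel)
         (simp add: emeasure_Diff emeasure_lborel_box_eq emeasure_lborel_cbox_eq null_setsI subset_box)
    with on_box[OF sub] show ?thesis by eventually_elim auto
  qed
  obtain \<D> where D: "countable \<D>" "\<D> \<subseteq> Pow S" "\<And>X. X \<in> \<D> \<Longrightarrow> \<exists>a b. X = cbox a b" "\<Union>\<D> = S"
    by (rule open_countable_Union_open_cbox[OF S]) (rule that)
  have "AE x in lebesgue. x \<in> X \<longrightarrow> h x = 0" if "X \<in> \<D>" for X
    using D(2) D(3)[OF that] that on_cbox by blast
  then have "AE x in lebesgue. \<forall>X\<in>\<D>. x \<in> X \<longrightarrow> h x = 0"
    by (subst AE_ball_countable[OF D(1)]) blast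
  then have "AE x in lebesgue. x \<in> S \<longrightarrow> h x = 0"
    by eventually_elim (use D(4) in auto)
  then show ?thesis using Sm by (simp add: AE_restrict_space_iff)
qed

section \<open>Change of variables under injective holomorphic maps\<close>

lemma lebesgue_measure_preserving:
  fixes T :: "'a::euclidean_space \<Rightarrow> 'b::euclidean_space"
  assumes "T \<in> borel \<rightarrow>\<^sub>M borel" "distr lborel borel T = lborel"
  shows "T \<in> lebesgue \<rightarrow>\<^sub>M lebesgue" "distr lebesgue lebesgue T = lebesgue"
proof -
  have T: "T \<in> lborel \<rightarrow>\<^sub>M lborel" using assms(1) by simp
  have "distr lebesgue lborel T = distr lborel lborel T"
    by (rule distr_completion[OF T])
  also have "\<dots> = distr lborel borel T" by (rule distr_cong) auto
  finally have eq: "distr lebesgue lborel T = lborel" using assms(2) by simp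
  show "T \<in> lebesgue \<rightarrow>\<^sub>M lebesgue"
    using T by (intro completion.measurable_completion2 measurable_completion) (simp_all add: eq)
  show "distr lebesgue lebesgue T = lebesgue"
    using completion.completion_distr_eq[of T lborel lborel] measurable_completion[OF T] by (simp add: eq)
qed

text \<open>Two mutually inverse linear maps that send boxes to boxes of the same size, hence preserve Lebesgue
  measure. They carry the change of variables from \<open>real ^ 2\<close> over to the complex plane.\<close>

definition complex_of_vec :: "real ^ 2 \<Rightarrow> complex" where
  "complex_of_vec v = Complex (v $ 1) (v $ 2)"

definition vec_of_complex :: "complex \<Rightarrow> real ^ 2" where
  "vec_of_complex z = vector [Re z, Im z]"

lemma vec_of_complex_nth [simp]: "vec_of_complex z $ 1 = Re z" "vec_of_complex z $ 2 = Im z"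
  by (simp_all add: vec_of_complex_def)

lemma complex_of_vec_sel [simp]: "Re (complex_of_vec v) = v $ 1" "Im (complex_of_vec v) = v $ 2"
  by (simp_all add: complex_of_vec_def)

lemma complex_of_vec_inverse [simp]: "vec_of_complex (complex_of_vec v) = v"
  by (simp add: vec_eq_iff forall_2)

lemma vec_of_complex_inverse [simp]: "complex_of_vec (vec_of_complex z) = z"
  by (simp add: complex_eq_iff)

lemma bounded_linear_complex_of_vec: "bounded_linear complex_of_vec"
  by (intro linear_conv_bounded_linear[THEN iffD1] linearI) (auto simp: complex_eq_iff)

lemma bounded_linear_vec_of_complex: "bounded_linear vec_of_complex"
  by (intro linear_conv_bounded_linear[THEN iffD1] linearI) (auto simp: vec_eq_iff forall_2)

lemma measurable_complex_of_vec: "complex_of_vec \<in> borel \<rightarrow>\<^sub>M borel"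
  using linear_continuous_on[OF bounded_linear_complex_of_vec] by (rule borel_measurable_continuous_onI)

lemma measurable_vec_of_complex: "vec_of_complex \<in> borel \<rightarrow>\<^sub>M borel"
  using linear_continuous_on[OF bounded_linear_vec_of_complex] by (rule borel_measurable_continuous_onI)

lemma Basis_real2: "(Basis :: (real^2) set) = {axis 1 1, axis 2 1}"
  by (auto simp: Basis_vec_def UNIV_2)

lemma axis_12_neq: "axis 1 (1::real) \<noteq> (axis 2 1 :: real^2)"
  by (simp add: axis_eq_axis)

lemma distr_complex_of_vec: "distr lborel borel complex_of_vec = lborel"
proof (rule lborel_eqI[symmetric])
  fix l u :: complex assume le: "\<And>b. b \<in> Basis \<Longrightarrow> l \<bullet> b \<le> u \<bullet> b"
  have "complex_of_vec -` box l u = box (vec_of_complex l) (vec_of_complex u)"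
    by (auto simp: mem_box Basis_complex_def Basis_real2 inner_axis axis_12_neq)
  moreover have "\<forall>b\<in>Basis. vec_of_complex l \<bullet> b \<le> vec_of_complex u \<bullet> b"
    using le[of 1] le[of \<i>] by (auto simp: Basis_complex_def Basis_real2 inner_axis)
  ultimately show "emeasure (distr lborel borel complex_of_vec) (box l u) = (\<Prod>b\<in>Basis. (u - l) \<bullet> b)"
    using measurable_complex_of_vec axis_12_neq
    by (simp add: emeasure_distr emeasure_lborel_box_eq Basis_complex_def Basis_real2 inner_axis inner_diff_left)
qed simp

lemma distr_vec_of_complex: "distr lborel borel vec_of_complex = lborel"
proof -
  have "distr (distr lborel borel complex_of_vec) borel vec_of_complex = distr lborel borel (vec_of_complex \<circ> complex_of_vec)"
    using measurable_complex_of_vec measurable_vec_of_complex by (intro distr_distr) auto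
  also have "\<dots> = distr lborel lborel id" by (rule distr_cong) auto
  finally show ?thesis by (simp add: distr_complex_of_vec distr_id2 id_def)
qed

lemma absolutely_integrable_complex_of_vec:
  fixes h :: "complex \<Rightarrow> real"
  shows "h absolutely_integrable_on S \<longleftrightarrow> (\<lambda>v. h (complex_of_vec v)) absolutely_integrable_on (complex_of_vec -` S)"
    and "h absolutely_integrable_on S \<Longrightarrow> integral S h = integral (complex_of_vec -` S) (\<lambda>v. h (complex_of_vec v))"
proof -
  note J = lebesgue_measure_preserving[OF measurable_complex_of_vec distr_complex_of_vec]
  note J' = lebesgue_measure_preserving[OF measurable_vec_of_complex distr_vec_of_complex]
  let ?h = "\<lambda>z. indicator S z *\<^sub>R h z"
  have ind: "(\<lambda>v. indicator (complex_of_vec -` S) v *\<^sub>R h (complex_of_vec v)) = (\<lambda>v. ?h (complex_of_vec v))"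
    by (auto simp: indicator_def)
  have iff: "integrable lebesgue ?h \<longleftrightarrow> integrable lebesgue (\<lambda>v. ?h (complex_of_vec v))"
  proof
    assume "integrable lebesgue ?h"
    then have "integrable (distr lebesgue lebesgue complex_of_vec) ?h" by (simp add: J)
    then show "integrable lebesgue (\<lambda>v. ?h (complex_of_vec v))" by (rule integrable_distr[OF J(1)])
  next
    assume "integrable lebesgue (\<lambda>v. ?h (complex_of_vec v))"
    then have "integrable (distr lebesgue lebesgue vec_of_complex) (\<lambda>v. ?h (complex_of_vec v))" by (simp add: J')
    from integrable_distr[OF J'(1) this] show "integrable lebesgue ?h" by simp
  qed
  then show i: "h absolutely_integrable_on S \<longleftrightarrow> (\<lambda>v. h (complex_of_vec v)) absolutely_integrable_on (complex_of_vec -` S)"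
    unfolding set_integrable_def ind .
  assume h: "h absolutely_integrable_on S"
  then have "integrable lebesgue ?h" by (simp add: set_integrable_def)
  then have m: "?h \<in> borel_measurable lebesgue" by simp
  have "integral\<^sup>L (distr lebesgue lebesgue complex_of_vec) ?h = integral\<^sup>L lebesgue (\<lambda>v. ?h (complex_of_vec v))"
    by (rule integral_distr[OF J(1) m])
  then have "(LINT z:S|lebesgue. h z) = (LINT v:complex_of_vec -` S|lebesgue. h (complex_of_vec v))"
    unfolding set_lebesgue_integral_def ind J(2) .
  then show "integral S h = integral (complex_of_vec -` S) (\<lambda>v. h (complex_of_vec v))"
    using set_lebesgue_integral_eq_integral(2) h i by metis
qed

text \<open>Real-valued integrands are treated as vectors of length one.\<close>

lemma has_absolute_integral_change_of_variables_vec_real: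
  fixes h :: "real^'m::{finite,wellorder} \<Rightarrow> real" and g :: "real^'m::_ \<Rightarrow> real^'m::_"
  assumes "S \<in> sets lebesgue" "\<And>x. x \<in> S \<Longrightarrow> (g has_derivative g' x) (at x within S)" "inj_on g S"
  shows "(\<lambda>x. \<bar>det (matrix (g' x))\<bar> * h (g x)) absolutely_integrable_on S \<and>
           integral S (\<lambda>x. \<bar>det (matrix (g' x))\<bar> * h (g x)) = b
     \<longleftrightarrow> h absolutely_integrable_on (g ` S) \<and> integral (g ` S) h = b"
proof -
  have "(\<lambda>x. \<bar>det (matrix (g' x))\<bar> *\<^sub>R vec (h (g x)) :: real ^ 1) absolutely_integrable_on S \<and>
           integral S (\<lambda>x. \<bar>det (matrix (g' x))\<bar> *\<^sub>R vec (h (g x))) = (vec b :: real ^ 1)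
         \<longleftrightarrow> (\<lambda>x. vec (h x) :: real ^ 1) absolutely_integrable_on (g ` S) \<and>
           integral (g ` S) (\<lambda>x. vec (h x)) = (vec b :: real ^ 1)"
    using assms by (intro has_absolute_integral_change_of_variables) auto
  thus ?thesis by (simp add: absolutely_integrable_on_1_iff integral_on_1_eq)
qed

lemma det_complex_mult:
  "det (matrix (\<lambda>v. vec_of_complex (c * complex_of_vec v))) = (cmod c)\<^sup>2"
  by (simp add: det_2 matrix_def axis_def cmod_power2) (simp add: power2_eq_square)

text \<open>Multiplication by \<open>f'\<close> is the derivative of \<open>f\<close> as a real map, and its determinant is \<open>\<bar>f'\<bar>\<^sup>2\<close>. The second
  part holds for all \<open>h\<close>, since by the first part both integrals take the default value 0 together.\<close>

theorem holomorphic_change_of_variables: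
  fixes h :: "complex \<Rightarrow> real"
  assumes "open S" "f holomorphic_on S" "inj_on f S"
  shows "integrable (lebesgue_on (f ` S)) h
           \<longleftrightarrow> integrable (lebesgue_on S) (\<lambda>z. (cmod (deriv f z))\<^sup>2 * h (f z))" (is ?int)
    and "(\<integral>w. h w \<partial>lebesgue_on (f ` S)) = (\<integral>z. (cmod (deriv f z))\<^sup>2 * h (f z) \<partial>lebesgue_on S)"
proof -
  define S2 where "S2 = complex_of_vec -` S"
  define g where "g v = vec_of_complex (f (complex_of_vec v))" for v
  define g' where "g' v w = vec_of_complex (deriv f (complex_of_vec v) * complex_of_vec w)" for v w
  have S2: "open S2"
    unfolding S2_def using assms(1) linear_continuous_on[OF bounded_linear_complex_of_vec]
    by (intro open_vimage) auto
  have der: "(g has_derivative g' v) (at v within S2)" if "v \<in> S2" for v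
  proof -
    have "(f has_derivative (*) (deriv f (complex_of_vec v))) (at (complex_of_vec v))"
      using holomorphic_derivI[OF assms(2,1)] that by (simp add: has_field_derivative_def S2_def)
    then have "((\<lambda>v. f (complex_of_vec v)) has_derivative (\<lambda>w. deriv f (complex_of_vec v) * complex_of_vec w)) (at v)"
      using has_derivative_compose[OF bounded_linear_imp_has_derivative[OF bounded_linear_complex_of_vec]] by blast
    from has_derivative_compose[OF this bounded_linear_imp_has_derivative[OF bounded_linear_vec_of_complex]]
    show ?thesis unfolding g_def[abs_def] g'_def[abs_def] by (rule has_derivative_at_withinI)
  qed
  have inj: "inj_on g S2"
    using assms(3) unfolding inj_on_def g_def S2_def
    by (metis complex_of_vec_inverse vec_of_complex_inverse vimageE)
  have img: "g ` S2 = complex_of_vec -` (f ` S)"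
  proof (intro set_eqI iffI)
    fix v assume "v \<in> complex_of_vec -` (f ` S)"
    then obtain z where z: "z \<in> S" "complex_of_vec v = f z" by auto
    then have "v = g (vec_of_complex z)"
      unfolding g_def by (metis complex_of_vec_inverse vec_of_complex_inverse)
    with z(1) show "v \<in> g ` S2" unfolding S2_def by simp
  qed (auto simp: g_def S2_def)
  have fS: "open (f ` S)" using open_mapping_thm3[OF assms(2,1,3)] .
  have D: "\<bar>det (matrix (g' v))\<bar> = (cmod (deriv f (complex_of_vec v)))\<^sup>2" for v
    unfolding g'_def[abs_def] det_complex_mult by simp
  let ?k = "\<lambda>z. (cmod (deriv f z))\<^sup>2 * h (f z)"
  have cov: "(\<lambda>v. ?k (complex_of_vec v)) absolutely_integrable_on S2 \<and> integral S2 (\<lambda>v. ?k (complex_of_vec v)) = b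
     \<longleftrightarrow> (\<lambda>v. h (complex_of_vec v)) absolutely_integrable_on g ` S2 \<and> integral (g ` S2) (\<lambda>v. h (complex_of_vec v)) = b" for b
    using has_absolute_integral_change_of_variables_vec_real[of S2 g g' "\<lambda>v. h (complex_of_vec v)" b] der inj S2
    by (simp add: D) (simp add: g_def)
  have abs: "integrable (lebesgue_on T) q \<longleftrightarrow> q absolutely_integrable_on T" if "open T" for T and q :: "complex \<Rightarrow> real"
    using that by (simp add: set_integrable_def integrable_restrict_space)
  note cov = cov[unfolded img, unfolded S2_def]
  have iff: "h absolutely_integrable_on (f ` S) \<longleftrightarrow> ?k absolutely_integrable_on S"
    using cov absolutely_integrable_complex_of_vec(1)[where h = h and S = "f ` S"] absolutely_integrable_complex_of_vec(1)[where h = ?k and S = S]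
    by blast
  then show ?int using abs fS assms(1) by blast
  show "(\<integral>w. h w \<partial>lebesgue_on (f ` S)) = (\<integral>z. ?k z \<partial>lebesgue_on S)"
  proof (cases "h absolutely_integrable_on (f ` S)")
    case True
    then have "integral (f ` S) h = integral S ?k"
      using cov absolutely_integrable_complex_of_vec[where h = h and S = "f ` S"]
        absolutely_integrable_complex_of_vec(2)[where h = ?k and S = S] iff by auto
    moreover have "integral\<^sup>L (lebesgue_on (f ` S)) h = integral (f ` S) h"
      using True fS by (intro lebesgue_integral_eq_integral) (simp_all add: abs)
    moreover have "integral\<^sup>L (lebesgue_on S) ?k = integral S ?k"
      using True iff assms(1) by (intro lebesgue_integral_eq_integral) (simp_all add: abs)
    ultimately show ?thesis by simp
  next
    case False
    then have "\<not> integrable (lebesgue_on (f ` S)) h" "\<not> integrable (lebesgue_on S) ?k"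
      using iff abs fS assms(1) by auto
    then show ?thesis by (simp add: not_integrable_integral_eq)
  qed
qed

section \<open>The weak gradient of a holomorphic pullback\<close>

lemma integrable_mult_bounded_continuous:
  fixes u c :: "'a::euclidean_space \<Rightarrow> real"
  assumes "integrable (lebesgue_on S) u" "continuous_on UNIV c" "compact K" "\<And>x. x \<notin> K \<Longrightarrow> c x = 0"
  shows "integrable (lebesgue_on S) (\<lambda>x. u x * c x)"
proof -
  obtain B where B: "\<bar>c x\<bar> \<le> B" for x
  proof -
    have "bounded (c ` K)"
      using assms(2,3) by (meson compact_continuous_image compact_imp_bounded continuous_on_subset subset_UNIV)
    then obtain B where "\<And>x. x \<in> K \<Longrightarrow> \<bar>c x\<bar> \<le> B" by (auto simp: bounded_iff)
    then have "\<bar>c x\<bar> \<le> max B 0" for x using assms(4)[of x] by (cases "x \<in> K") force+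
    with that show thesis by blast
  qed
  have "c \<in> borel_measurable lborel" using assms(2) by (simp add: borel_measurable_continuous_onI)
  then have c: "c \<in> borel_measurable (lebesgue_on S)"
    by (intro measurable_restrict_space1 measurable_completion)
  show ?thesis
  proof (rule Bochner_Integration.integrable_bound)
    show "integrable (lebesgue_on S) (\<lambda>x. B * norm (u x))" using assms(1) by simp
    show "AE x in lebesgue_on S. norm (u x * c x) \<le> norm (B * norm (u x))"
    proof (intro AE_I2)
      fix x
      have "\<bar>u x\<bar> * \<bar>c x\<bar> \<le> \<bar>u x\<bar> * B" by (intro mult_left_mono B) auto
      also have "\<dots> \<le> \<bar>B\<bar> * \<bar>u x\<bar>" by (metis abs_ge_self abs_ge_zero mult.commute mult_right_mono)
      finally show "norm (u x * c x) \<le> norm (B * norm (u x))" by (simp add: abs_mult)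
    qed
    show "(\<lambda>x. u x * c x) \<in> borel_measurable (lebesgue_on S)"
      using assms(1) c by (intro borel_measurable_times) auto
  qed
qed

lemma test_function_differentiable:
  assumes "test_function S \<phi>"
  shows "(\<phi> has_derivative frechet_derivative \<phi> (at x)) (at x)"
    and "continuous_on UNIV (\<lambda>x. frechet_derivative \<phi> (at x) b)"
proof -
  have "Ck_on (Suc 0) UNIV \<phi>" using assms unfolding test_function_def smooth_on_def by blast
  from Ck_on_has_derivative[OF this, of x] this
  show "(\<phi> has_derivative frechet_derivative \<phi> (at x)) (at x)"
    "continuous_on UNIV (\<lambda>x. frechet_derivative \<phi> (at x) b)" by simp_all
qed

lemma test_function_eq_0_outside:
  assumes "test_function S \<phi>" "x \<notin> closure {x. \<phi> x \<noteq> 0}"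
  shows "\<phi> x = 0" and "frechet_derivative \<phi> (at x) b = 0"
proof -
  have zero: "\<phi> x = 0" if "x \<notin> closure {x. \<phi> x \<noteq> 0}" for x
    using that closure_subset[of "{x. \<phi> x \<noteq> 0}"] by blast
  then show "\<phi> x = 0" using assms(2) .
  have "(\<phi> has_derivative (\<lambda>_. 0)) (at x)"
  proof (rule has_derivative_transform_within_open[OF has_derivative_const[of 0]])
    show "open (- closure {x. \<phi> x \<noteq> 0})" by (intro open_Compl closed_closure)
    show "x \<in> - closure {x. \<phi> x \<noteq> 0}" using assms(2) by (simp only: Compl_iff not_False_eq_True)
    show "0 = \<phi> y" if "y \<in> - closure {x. \<phi> x \<noteq> 0}" for y
      by (rule zero[symmetric]) (use that in \<open>simp only: Compl_iff not_False_eq_True\<close>)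
  qed
  then show "frechet_derivative \<phi> (at x) b = 0" by (simp add: frechet_derivative_at[symmetric])
qed

lemma integrable_mult_test_function:
  assumes "integrable (lebesgue_on S) u" "test_function S \<phi>"
  shows "integrable (lebesgue_on S) (\<lambda>x. u x * \<phi> x)"
    and "integrable (lebesgue_on S) (\<lambda>x. u x * frechet_derivative \<phi> (at x) b)"
proof -
  have K: "compact (closure {x. \<phi> x \<noteq> 0})" using assms(2) unfolding test_function_def by blast
  show "integrable (lebesgue_on S) (\<lambda>x. u x * \<phi> x)"
    using integrable_mult_bounded_continuous[OF assms(1) test_function_continuous[OF assms(2)] K]
      test_function_eq_0_outside(1)[OF assms(2)] by blast
  show "integrable (lebesgue_on S) (\<lambda>x. u x * frechet_derivative \<phi> (at x) b)"
    using integrable_mult_bounded_continuous[OF assms(1) test_function_differentiable(2)[OF assms(2)] K]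
      test_function_eq_0_outside(2)[OF assms(2)] by blast
qed

text \<open>The test functions on the image domain \<open>W\<close> that the chain rule needs: a test function is transported by
  the inverse \<open>F\<close> of the conformal map and multiplied by one component of a vector field on \<open>W\<close>, given
  as the real part of a holomorphic function.\<close>

definition push_test :: "complex set \<Rightarrow> (complex \<Rightarrow> complex) \<Rightarrow> (complex \<Rightarrow> complex) \<Rightarrow> (complex \<Rightarrow> real) \<Rightarrow> complex \<Rightarrow> real" where
  "push_test W F G \<eta> w = (if w \<in> W then Re (G w) * \<eta> (F w) else 0)"

text \<open>The support is contained in the image under \<open>f\<close> of the compact support of \<open>\<eta>\<close>. Hence the extension by zero is
  smooth: the whole plane is the union of \<open>W\<close>, where smoothness is inherited from the factors, and the
  complement of this compact image, where the function vanishes.\<close>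

lemma test_function_push_test:
  assumes W: "open W" and F: "F holomorphic_on W" and G: "G holomorphic_on W" and \<eta>: "test_function D \<eta>"
    and f: "continuous_on D f" "f ` D \<subseteq> W" "\<And>w. w \<in> W \<Longrightarrow> f (F w) = w"
  shows "test_function W (push_test W F G \<eta>)"
proof -
  let ?\<zeta> = "push_test W F G \<eta>"
  define K where "K = closure {z. \<eta> z \<noteq> 0}"
  have K: "compact K" "K \<subseteq> D" and smooth: "Ck_on n UNIV \<eta>" for n
    using \<eta> unfolding test_function_def smooth_on_def K_def by auto
  have fK: "compact (f ` K)" "f ` K \<subseteq> W"
    using K f by (auto intro!: compact_continuous_image intro: continuous_on_subset)
  have zero: "?\<zeta> w = 0" if "w \<notin> f ` K" for w
  proof (cases "w \<in> W")
    case True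
    then have "F w \<notin> K" using that f(3) by force
    then have "\<eta> (F w) = 0" unfolding K_def by (rule test_function_eq_0_outside(1)[OF \<eta>])
    then show ?thesis by (simp add: push_test_def)
  qed (simp add: push_test_def)
  have "Ck_on n UNIV ?\<zeta>" for n
  proof -
    have "Ck_on n W (\<lambda>w. Re (G w) * \<eta> (F w))"
      by (rule Ck_on_mult[OF W Ck_on_Re_holomorphic[OF W G] Ck_on_comp_holomorphic[OF W F smooth]])
    then have 1: "Ck_on n W ?\<zeta>"
      by (rule Ck_on_cong[OF W, rotated]) (simp add: push_test_def)
    have o: "open (- f ` K)" using fK by (simp add: compact_imp_closed open_Compl)
    have 2: "Ck_on n (- f ` K) ?\<zeta>"
      by (rule Ck_on_cong[OF o _ Ck_on_const[OF o, of n 0]]) (simp add: zero)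
    have "W \<union> - f ` K = UNIV" using fK by auto
    with Ck_on_Un[OF W o 1 2] show ?thesis by simp
  qed
  moreover have supp: "closure {w. ?\<zeta> w \<noteq> 0} \<subseteq> f ` K"
    using fK zero by (intro closure_minimal compact_imp_closed) auto
  moreover have "compact (closure {w. ?\<zeta> w \<noteq> 0})"
    using bounded_subset[OF compact_imp_bounded[OF fK(1)] supp] by (simp add: compact_eq_bounded_closed)
  ultimately show ?thesis
    unfolding test_function_def smooth_on_def using fK(2) by blast
qed

lemma frechet_derivative_push_test:
  assumes "open W" "F holomorphic_on W" "G holomorphic_on W" "w \<in> W" "(\<eta> has_derivative \<eta>') (at (F w))"
  shows "frechet_derivative (push_test W F G \<eta>) (at w) b
       = Re (G w) * \<eta>' (deriv F w * b) + Re (deriv G w * b) * \<eta> (F w)"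
proof -
  have G': "((\<lambda>w. Re (G w)) has_derivative (\<lambda>b. Re (deriv G w * b))) (at w)"
    using holomorphic_derivI[OF assms(3,1,4)]
    by (intro has_derivative_Re) (simp add: has_field_derivative_def)
  have "((\<lambda>w. Re (G w) * \<eta> (F w)) has_derivative
      (\<lambda>b. Re (G w) * \<eta>' (deriv F w * b) + Re (deriv G w * b) * \<eta> (F w))) (at w)"
    by (rule has_derivative_mult[OF G' has_derivative_comp_holomorphic[OF assms(1,2,4,5)]])
  then have "(push_test W F G \<eta> has_derivative
      (\<lambda>b. Re (G w) * \<eta>' (deriv F w * b) + Re (deriv G w * b) * \<eta> (F w))) (at w)"
    by (rule has_derivative_transform_within_open[OF _ assms(1,4)]) (simp add: push_test_def)
  then show ?thesis by (simp add: frechet_derivative_at[symmetric])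
qed

text \<open>With \<open>F\<close> the inverse of \<open>f\<close>, let \<open>P\<close> and \<open>Q\<close> be \<open>\<eta> \<circ> F\<close> times the components of the field
  \<open>b * cnj F'\<close>. The key identity \<open>div\<close> in the proof says that the divergence of the pair \<open>(P, Q)\<close> at \<open>w\<close>
  is \<open>\<bar>F' w\<bar>\<^sup>2\<close> times the derivative of \<open>\<eta>\<close> at \<open>F w\<close> in the direction \<open>b\<close>, where the factor is exactly the
  Jacobian of the change of variables. The weak gradient of \<open>u\<close> is then tested with \<open>P\<close> in the
  direction 1 and with \<open>Q\<close> in the direction \<open>\<i>\<close>.\<close>

theorem has_weak_gradient_holomorphic_pullback:
  fixes u :: "complex \<Rightarrow> real"
  assumes D: "open D" and f: "f holomorphic_on D" and inj: "inj_on f D"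
    and u: "integrable (lebesgue_on (f ` D)) u"
    and g: "\<And>b. integrable (lebesgue_on (f ` D)) (\<lambda>w. g w \<bullet> b)"
    and weak: "has_weak_gradient (f ` D) u g"
  shows "has_weak_gradient D (u \<circ> f) (\<lambda>z. cnj (deriv f z) * g (f z))"
  unfolding has_weak_gradient_def
proof (intro allI impI)
  fix \<eta> :: "complex \<Rightarrow> real" and b :: complex
  assume \<eta>: "test_function D \<eta>" and b: "b \<in> Basis"
  define W where "W = f ` D"
  have W: "open W" unfolding W_def using open_mapping_thm3[OF f D inj] .
  obtain F where F: "F holomorphic_on W" and dF: "\<And>z. z \<in> D \<Longrightarrow> deriv f z * deriv F (f z) = 1"
      and Ff: "\<And>z. z \<in> D \<Longrightarrow> F (f z) = z"
    unfolding W_def using holomorphic_has_inverse[OF f D inj] by metis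
  have fF: "f (F w) = w" if "w \<in> W" for w using that Ff unfolding W_def by auto
  \<comment> \<open>The field \<open>b * cnj F'\<close> is the conjugate of the holomorphic function \<open>G\<close>, so its components are
    \<open>Re G\<close> and \<open>- Im G = Re (\<i> * G)\<close>.\<close>
  define G where "G w = cnj b * deriv F w" for w
  have G: "G holomorphic_on W" and iG: "(\<lambda>w. \<i> * G w) holomorphic_on W"
    unfolding G_def by (intro holomorphic_intros holomorphic_deriv F W)+
  let ?P = "push_test W F G \<eta>" and ?Q = "push_test W F (\<lambda>w. \<i> * G w) \<eta>"
  have P: "test_function W ?P" and Q: "test_function W ?Q"
    using test_function_push_test[OF W F _ \<eta> holomorphic_on_imp_continuous_on[OF f] _ fF] G iG W_def by auto
  have div: "frechet_derivative ?P (at w) 1 + frechet_derivative ?Q (at w) \<i>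
      = (cmod (deriv F w))\<^sup>2 * frechet_derivative \<eta> (at (F w)) b" if w: "w \<in> W" for w
  proof -
    let ?\<eta>' = "frechet_derivative \<eta> (at (F w))"
    have d\<eta>: "(\<eta> has_derivative ?\<eta>') (at (F w))" by (rule test_function_differentiable[OF \<eta>])
    interpret linear ?\<eta>' using d\<eta> has_derivative_linear by blast
    have dG: "deriv (\<lambda>w. \<i> * G w) w = \<i> * deriv G w"
      using holomorphic_derivI[OF G W w] by (intro DERIV_imp_deriv DERIV_cmult)
    \<comment> \<open>The terms in which \<open>G\<close> is differentiated are \<open>Re G'\<close> and \<open>Re (\<i> * G' * \<i>)\<close> and cancel: the field is
      divergence free.\<close>
    have "frechet_derivative ?P (at w) 1 + frechet_derivative ?Q (at w) \<i>
        = Re (G w) * ?\<eta>' (deriv F w) + Re (\<i> * G w) * ?\<eta>' (deriv F w * \<i>)"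
      by (simp add: frechet_derivative_push_test[OF W F G w d\<eta>] frechet_derivative_push_test[OF W F iG w d\<eta>] dG)
    also have "\<dots> = ?\<eta>' (Re (G w) *\<^sub>R deriv F w + Re (\<i> * G w) *\<^sub>R (deriv F w * \<i>))"
      by (simp only: add scaleR real_scaleR_def)
    also have "Re (G w) *\<^sub>R deriv F w + Re (\<i> * G w) *\<^sub>R (deriv F w * \<i>) = (cmod (deriv F w))\<^sup>2 *\<^sub>R b"
      by (simp add: G_def complex_eq_iff cmod_power2) (simp add: algebra_simps power2_eq_square)
    finally show ?thesis by (simp add: scaleR)
  qed
  have Pv: "?P w = Re (G w) * \<eta> (F w)" "?Q w = Re (\<i> * G w) * \<eta> (F w)" if "w \<in> W" for w
    using that by (simp_all add: push_test_def)
  have "(\<integral>z. (u \<circ> f) z * frechet_derivative \<eta> (at z) b \<partial>lebesgue_on D)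
      = (\<integral>z. (cmod (deriv f z))\<^sup>2 * (u (f z) * ((cmod (deriv F (f z)))\<^sup>2 * frechet_derivative \<eta> (at (F (f z))) b)) \<partial>lebesgue_on D)"
  proof (rule Bochner_Integration.integral_cong[OF refl])
    fix z assume "z \<in> space (lebesgue_on D)"
    then have z: "z \<in> D" by simp
    have "(cmod (deriv f z))\<^sup>2 * (cmod (deriv F (f z)))\<^sup>2 = 1"
      using dF[OF z] by (metis norm_mult norm_one power_mult_distrib power_one)
    then show "(u \<circ> f) z * frechet_derivative \<eta> (at z) b
      = (cmod (deriv f z))\<^sup>2 * (u (f z) * ((cmod (deriv F (f z)))\<^sup>2 * frechet_derivative \<eta> (at (F (f z))) b))"
      using Ff[OF z] by (simp add: algebra_simps)
  qed
  also have "\<dots> = (\<integral>w. u w * ((cmod (deriv F w))\<^sup>2 * frechet_derivative \<eta> (at (F w)) b) \<partial>lebesgue_on W)"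
    unfolding W_def by (rule holomorphic_change_of_variables(2)[OF D f inj, symmetric])
  also have "\<dots> = (\<integral>w. u w * frechet_derivative ?P (at w) 1 + u w * frechet_derivative ?Q (at w) \<i> \<partial>lebesgue_on W)"
    by (rule Bochner_Integration.integral_cong[OF refl]) (simp add: div[symmetric] distrib_left)
  also have "\<dots> = (\<integral>w. u w * frechet_derivative ?P (at w) 1 \<partial>lebesgue_on W)
      + (\<integral>w. u w * frechet_derivative ?Q (at w) \<i> \<partial>lebesgue_on W)"
    using integrable_mult_test_function(2) u P Q unfolding W_def by (intro Bochner_Integration.integral_add) blast+
  also have "\<dots> = - (\<integral>w. (g w \<bullet> 1) * ?P w \<partial>lebesgue_on W) + - (\<integral>w. (g w \<bullet> \<i>) * ?Q w \<partial>lebesgue_on W)"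
    using weak P Q unfolding has_weak_gradient_def W_def[symmetric] by (simp add: Basis_complex_def)
  also have "\<dots> = - ((\<integral>w. (g w \<bullet> 1) * ?P w \<partial>lebesgue_on W) + (\<integral>w. (g w \<bullet> \<i>) * ?Q w \<partial>lebesgue_on W))"
    by simp
  also have "(\<integral>w. (g w \<bullet> 1) * ?P w \<partial>lebesgue_on W) + (\<integral>w. (g w \<bullet> \<i>) * ?Q w \<partial>lebesgue_on W)
      = (\<integral>w. (g w \<bullet> 1) * ?P w + (g w \<bullet> \<i>) * ?Q w \<partial>lebesgue_on W)"
    using integrable_mult_test_function(1)[OF g] P Q unfolding W_def
    by (intro Bochner_Integration.integral_add[symmetric]) blast+
  also have "\<dots> = (\<integral>w. (g w \<bullet> (b * cnj (deriv F w))) * \<eta> (F w) \<partial>lebesgue_on W)"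
    by (rule Bochner_Integration.integral_cong[OF refl])
       (simp add: Pv, simp add: G_def inner_complex_def algebra_simps)
  also have "\<dots> = (\<integral>z. (cmod (deriv f z))\<^sup>2 * ((g (f z) \<bullet> (b * cnj (deriv F (f z)))) * \<eta> (F (f z))) \<partial>lebesgue_on D)"
    unfolding W_def by (rule holomorphic_change_of_variables(2)[OF D f inj])
  also have "\<dots> = (\<integral>z. ((cnj (deriv f z) * g (f z)) \<bullet> b) * \<eta> z \<partial>lebesgue_on D)"
  proof (rule Bochner_Integration.integral_cong[OF refl])
    fix z assume "z \<in> space (lebesgue_on D)"
    then have z: "z \<in> D" by simp
    have "of_real ((cmod (deriv f z))\<^sup>2) * (b * cnj (deriv F (f z))) = deriv f z * b * cnj (deriv f z * deriv F (f z))"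
      by (simp only: complex_norm_square complex_cnj_mult mult_ac)
    also have "\<dots> = deriv f z * b" by (simp add: dF[OF z])
    finally have "(cmod (deriv f z))\<^sup>2 *\<^sub>R (b * cnj (deriv F (f z))) = deriv f z * b"
      by (simp add: scaleR_conv_of_real)
    then have "(cmod (deriv f z))\<^sup>2 * (g (f z) \<bullet> (b * cnj (deriv F (f z)))) = g (f z) \<bullet> (deriv f z * b)"
      by (metis inner_scaleR_right)
    also have "\<dots> = (cnj (deriv f z) * g (f z)) \<bullet> b"
      by (simp add: inner_complex_def algebra_simps)
    finally show "(cmod (deriv f z))\<^sup>2 * ((g (f z) \<bullet> (b * cnj (deriv F (f z)))) * \<eta> (F (f z)))
       = ((cnj (deriv f z) * g (f z)) \<bullet> b) * \<eta> z"
      using Ff[OF z] by (simp add: mult.assoc[symmetric])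
  qed
  finally show "(\<integral>z. (u \<circ> f) z * frechet_derivative \<eta> (at z) b \<partial>lebesgue_on D)
      = - (\<integral>z. ((cnj (deriv f z) * g (f z)) \<bullet> b) * \<eta> z \<partial>lebesgue_on D)" .
qed

section \<open>Conformal invariance of the Dirichlet integral\<close>

text \<open>On a set of finite measure, square integrable functions are integrable because \<open>t \<le> 1 + t\<^sup>2\<close>.\<close>

lemma integrable_inner_square_integrable:
  assumes "S \<in> lmeasurable" "square_integrable_on S u"
  shows "integrable (lebesgue_on S) (\<lambda>x. u x \<bullet> b)"
proof (rule Bochner_Integration.integrable_bound)
  show "integrable (lebesgue_on S) (\<lambda>x. (1 + (norm (u x))\<^sup>2) * norm b)"
    using assms(2) finite_measure.integrable_const[OF finite_measure_lebesgue_on[OF assms(1)]]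
    by (intro integrable_mult_left Bochner_Integration.integrable_add) (auto simp: square_integrable_on_def)
  show "(\<lambda>x. u x \<bullet> b) \<in> borel_measurable (lebesgue_on S)"
    using assms(2) unfolding square_integrable_on_def by (intro borel_measurable_inner) auto
  show "AE x in lebesgue_on S. norm (u x \<bullet> b) \<le> norm ((1 + (norm (u x))\<^sup>2) * norm b)"
  proof (intro AE_I2)
    fix x
    have "2 * norm (u x) \<le> 1 + (norm (u x))\<^sup>2"
      using zero_le_power2[of "norm (u x) - 1"] by (simp add: power2_diff)
    then have "norm (u x) \<le> 1 + (norm (u x))\<^sup>2" using norm_ge_zero[of "u x"] by linarith
    then have "norm (u x) * norm b \<le> (1 + (norm (u x))\<^sup>2) * norm b" by (intro mult_right_mono) auto
    then show "norm (u x \<bullet> b) \<le> norm ((1 + (norm (u x))\<^sup>2) * norm b)"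
      using Cauchy_Schwarz_ineq2[of "u x" b] by simp
  qed
qed

lemma weak_gradient_unique:
  assumes S: "open S" "S \<in> lmeasurable"
    and "square_integrable_on S g" "square_integrable_on S g'"
    and "has_weak_gradient S u g" "has_weak_gradient S u g'"
  shows "AE x in lebesgue_on S. g x = g' x"
proof -
  have "AE x in lebesgue_on S. g x \<bullet> b - g' x \<bullet> b = 0" if b: "b \<in> Basis" for b
  proof (rule fundamental_lemma_calculus_of_variations[OF S(1)])
    have i: "integrable (lebesgue_on S) (\<lambda>x. g x \<bullet> b)" "integrable (lebesgue_on S) (\<lambda>x. g' x \<bullet> b)"
      by (intro integrable_inner_square_integrable assms)+
    then show "integrable (lebesgue_on S) (\<lambda>x. g x \<bullet> b - g' x \<bullet> b)" by simp
    fix \<phi> :: "'a \<Rightarrow> real" assume \<phi>: "test_function S \<phi>"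
    have "(\<integral>x. (g x \<bullet> b - g' x \<bullet> b) * \<phi> x \<partial>lebesgue_on S)
        = (\<integral>x. (g x \<bullet> b) * \<phi> x \<partial>lebesgue_on S) - (\<integral>x. (g' x \<bullet> b) * \<phi> x \<partial>lebesgue_on S)"
      unfolding left_diff_distrib
      by (intro Bochner_Integration.integral_diff integrable_mult_test_function(1)[OF _ \<phi>] i)
    moreover have "- (\<integral>x. (g x \<bullet> b) * \<phi> x \<partial>lebesgue_on S) = - (\<integral>x. (g' x \<bullet> b) * \<phi> x \<partial>lebesgue_on S)"
      using assms(5,6)[unfolded has_weak_gradient_def, rule_format, OF \<phi> b] by (rule trans[OF sym])
    ultimately show "(\<integral>x. (g x \<bullet> b - g' x \<bullet> b) * \<phi> x \<partial>lebesgue_on S) = 0" by simp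
  qed
  then have "AE x in lebesgue_on S. \<forall>b\<in>Basis. g x \<bullet> b - g' x \<bullet> b = 0"
    by (intro AE_finite_allI finite_Basis)
  then show ?thesis by eventually_elim (auto intro: euclidean_eqI)
qed

lemma weak_grad_works:
  assumes "square_integrable_on S g" "has_weak_gradient S u g"
  shows "square_integrable_on S (weak_grad S u)" "has_weak_gradient S u (weak_grad S u)"
  unfolding weak_grad_def using someI[of "\<lambda>g. square_integrable_on S g \<and> has_weak_gradient S u g" g] assms
  by blast+

text \<open>By uniqueness, the Dirichlet integral can be computed from any square integrable weak gradient.\<close>

lemma dirichlet_integral_eq:
  assumes "open S" "S \<in> lmeasurable" "square_integrable_on S g" "has_weak_gradient S u g"
  shows "(\<integral>x. (norm (weak_grad S u x))\<^sup>2 \<partial>lebesgue_on S) = (\<integral>x. (norm (g x))\<^sup>2 \<partial>lebesgue_on S)"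
proof (rule integral_cong_AE)
  note wg = weak_grad_works[OF assms(3,4)]
  show "AE x in lebesgue_on S. (norm (weak_grad S u x))\<^sup>2 = (norm (g x))\<^sup>2"
    using weak_gradient_unique[OF assms(1,2) wg(1) assms(3) wg(2) assms(4)] by eventually_elim simp
qed (use weak_grad_works[OF assms(3,4)] assms(3) in \<open>auto simp: square_integrable_on_def\<close>)

text \<open>Composition of a Lebesgue measurable function with a continuous one may fail to be measurable. Here
  the change of variables provides measurability of the product with \<open>\<bar>f'\<bar>\<^sup>2\<close>, and \<open>f'\<close> has no zeros.\<close>

lemma measurable_holomorphic_pullback:
  fixes u :: "complex \<Rightarrow> 'b::euclidean_space"
  assumes D: "open D" and f: "f holomorphic_on D" and inj: "inj_on f D"
    and u: "\<And>b. integrable (lebesgue_on (f ` D)) (\<lambda>w. u w \<bullet> b)"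
  shows "(\<lambda>z. u (f z)) \<in> borel_measurable (lebesgue_on D)"
proof (rule borel_measurable_euclidean_space[THEN iffD2, rule_format])
  fix b :: 'b
  have "continuous_on D (deriv f)"
    by (intro holomorphic_on_imp_continuous_on holomorphic_deriv f D)
  then have f': "deriv f \<in> borel_measurable (lebesgue_on D)"
    using D by (intro continuous_imp_measurable_on_sets_lebesgue) auto
  have "integrable (lebesgue_on D) (\<lambda>z. (cmod (deriv f z))\<^sup>2 * (u (f z) \<bullet> b))"
    using holomorphic_change_of_variables(1)[OF D f inj, of "\<lambda>w. u w \<bullet> b"] u by blast
  then have "(\<lambda>z. ((cmod (deriv f z))\<^sup>2 * (u (f z) \<bullet> b)) / (cmod (deriv f z))\<^sup>2) \<in> borel_measurable (lebesgue_on D)"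
    using f' by (intro borel_measurable_divide) auto
  then show "(\<lambda>z. u (f z) \<bullet> b) \<in> borel_measurable (lebesgue_on D)"
    by (rule measurable_cong[THEN iffD1, rotated])
       (use holomorphic_injective_imp_regular[OF f D inj] in auto)
qed

text \<open>The norm of the pulled back gradient \<open>cnj f' * (g \<circ> f)\<close> carries the factor \<open>\<bar>f'\<bar>\<close>, and its square is
  precisely the Jacobian; this is special to dimension two.\<close>

theorem dirichlet_integral_holomorphic_pullback:
  assumes D: "open D" "D \<in> lmeasurable" and f: "f holomorphic_on D" and inj: "inj_on f D"
    and fD: "f ` D \<in> lmeasurable" and u: "u \<in> H1 (f ` D)"
  shows "(\<integral>z. (norm (weak_grad D (u \<circ> f) z))\<^sup>2 \<partial>lebesgue_on D)
       = (\<integral>w. (norm (weak_grad (f ` D) u w))\<^sup>2 \<partial>lebesgue_on (f ` D))"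
proof -
  define g where "g = weak_grad (f ` D) u"
  have u2: "square_integrable_on (f ` D) u" and g2: "square_integrable_on (f ` D) g" and g: "has_weak_gradient (f ` D) u g"
    using u weak_grad_works unfolding H1_def g_def by blast+
  have ui: "integrable (lebesgue_on (f ` D)) u"
    using integrable_inner_square_integrable[OF fD u2, of 1] by simp
  have gi: "integrable (lebesgue_on (f ` D)) (\<lambda>w. g w \<bullet> b)" for b
    by (rule integrable_inner_square_integrable[OF fD g2])
  let ?G = "\<lambda>z. cnj (deriv f z) * g (f z)"
  have G: "has_weak_gradient D (u \<circ> f) ?G"
    by (rule has_weak_gradient_holomorphic_pullback[OF D(1) f inj ui gi g])
  have nG: "(norm (?G z))\<^sup>2 = (cmod (deriv f z))\<^sup>2 * (norm (g (f z)))\<^sup>2" for z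
    by (simp add: norm_mult power_mult_distrib)
  have "continuous_on D (\<lambda>z. cnj (deriv f z))"
    by (intro continuous_intros holomorphic_on_imp_continuous_on holomorphic_deriv f D)
  then have f': "(\<lambda>z. cnj (deriv f z)) \<in> borel_measurable (lebesgue_on D)"
    using D by (intro continuous_imp_measurable_on_sets_lebesgue) auto
  have "?G \<in> borel_measurable (lebesgue_on D)"
    by (intro borel_measurable_times f' measurable_holomorphic_pullback[OF D(1) f inj gi])
  moreover have "integrable (lebesgue_on D) (\<lambda>z. (norm (?G z))\<^sup>2)"
    unfolding nG holomorphic_change_of_variables(1)[OF D(1) f inj, symmetric, where h = "\<lambda>w. (norm (g w))\<^sup>2"]
    using g2 by (simp add: square_integrable_on_def)
  ultimately have "square_integrable_on D ?G" by (simp add: square_integrable_on_def)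
  from dirichlet_integral_eq[OF D this G] show ?thesis
    unfolding nG holomorphic_change_of_variables(2)[OF D(1) f inj, symmetric, where h = "\<lambda>w. (norm (g w))\<^sup>2"]
    by (simp add: g_def)
qed

section \<open>The eigenvalue estimate\<close>

lemma deriv_lower_bound_lipschitz_inverse:
  assumes D: "open D" and f: "f holomorphic_on D" and inj: "inj_on f D"
    and M: "M-lipschitz_on (f ` D) (inv_into D f)" and z: "z \<in> D"
  shows "1 \<le> M * cmod (deriv f z)"
proof (rule tendsto_lowerbound)
  have "((\<lambda>w. (f w - f z) / (w - z)) \<longlongrightarrow> deriv f z) (at z)"
    using holomorphic_derivI[OF f D z] by (simp add: has_field_derivative_iff)
  then show "((\<lambda>w. M * cmod ((f w - f z) / (w - z))) \<longlongrightarrow> M * cmod (deriv f z)) (at z)"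
    by (intro tendsto_intros)
  show "\<forall>\<^sub>F w in at z. 1 \<le> M * cmod ((f w - f z) / (w - z))"
    using eventually_at_in_open'[OF D z] eventually_neq_at_within[of z z UNIV]
  proof eventually_elim
    case (elim w)
    have "dist (inv_into D f (f w)) (inv_into D f (f z)) \<le> M * dist (f w) (f z)"
      using elim z by (intro lipschitz_onD[OF M]) auto
    then have "cmod (w - z) \<le> M * cmod (f w - f z)"
      using elim z inj by (simp add: dist_norm)
    then show ?case using elim by (simp add: norm_divide field_simps)
  qed
qed simp

text \<open>It remains to combine the minimum property of \<open>lamD\<close>, tested with \<open>\<psi>\<close>, with the pointwise inequality
  \<open>2 * \<bar>Re c\<bar> \<le> 1 + \<bar>c\<bar>\<^sup>2\<close> for \<open>c = f' z\<close>.\<close>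

theorem theorem9:
  fixes \<Omega> :: "complex set" and f :: "complex \<Rightarrow> complex" and a :: "nat \<Rightarrow> complex"
    and \<gamma>0 \<gamma>1 \<gamma>0' \<gamma>1' :: "complex set"
    and lam\<Omega> lamD :: real and \<phi> :: "complex \<Rightarrow> real"
  assumes "simply_connected \<Omega>" and "bounded \<Omega>" and "lipschitz_domain \<Omega>"
    and "f holomorphic_on ball 0 1" and "bilipschitz_on (ball 0 1) f"
    and "f ` ball 0 1 = \<Omega>"
    and "\<exists>g. homeomorphism (cball 0 1) (closure \<Omega>) f g"
    and "\<forall>z\<in>ball 0 1. (\<lambda>n. a n * z ^ n) sums f z" and "a 1 \<in> \<real>"
    and "\<gamma>0' \<subseteq> sphere 0 1" and "\<gamma>1' \<subseteq> sphere 0 1"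
    and "\<gamma>0 = f ` \<gamma>0'" and "\<gamma>1 = f ` \<gamma>1'"
    and "openin (top_of_set (frontier \<Omega>)) \<gamma>0" and "openin (top_of_set (frontier \<Omega>)) \<gamma>1"
    and "\<gamma>0 \<inter> \<gamma>1 = {}" and "closure \<gamma>0 \<union> closure \<gamma>1 = frontier \<Omega>"
    and "is_first_eigenvalue \<Omega> (mixed_space \<Omega> \<gamma>0) lam\<Omega>"
    and "is_first_eigenvalue (ball 0 1) ((\<lambda>v. v \<circ> f) ` mixed_space \<Omega> \<gamma>0) lamD"
    and "weak_eigenfunction \<Omega> (mixed_space \<Omega> \<gamma>0) lam\<Omega> \<phi>"
  shows "lam\<Omega> \<ge> lamD * (2 * (\<integral>z. (\<phi> (f z))\<^sup>2 * Re (deriv f z) \<partial>lebesgue_on (ball 0 1)) - 1)"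
proof -
  define D where "D = ball (0::complex) 1"
  let ?M = "lebesgue_on D" and ?V = "mixed_space \<Omega> \<gamma>0"
  have D: "open D" "D \<in> lmeasurable" by (simp_all add: D_def)
  have f: "f holomorphic_on D" and fD: "f ` D = \<Omega>" and inj: "inj_on f D"
    using assms by (simp_all add: D_def bilipschitz_on_def)
  have \<Omega>: "\<Omega> \<in> lmeasurable"
    using assms(2,3) by (simp add: lipschitz_domain_def lmeasurable_open)
  have \<phi>V: "\<phi> \<in> ?V" and norm1: "(\<integral>w. (\<phi> w)\<^sup>2 \<partial>lebesgue_on \<Omega>) = 1"
    using assms(20) by (auto simp: weak_eigenfunction_def)
  have \<phi>H: "\<phi> \<in> H1 \<Omega>" using \<phi>V by (simp add: mixed_space_def H1_closure_def)
  then have \<phi>2: "square_integrable_on \<Omega> \<phi>" by (simp add: H1_def)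
  define \<psi> where "\<psi> = \<phi> \<circ> f"
  have energy: "(\<integral>z. (norm (weak_grad D \<psi> z))\<^sup>2 \<partial>?M) = lam\<Omega>"
  proof -
    have "(\<integral>z. (norm (weak_grad D \<psi> z))\<^sup>2 \<partial>?M) = (\<integral>w. (norm (weak_grad \<Omega> \<phi> w))\<^sup>2 \<partial>lebesgue_on \<Omega>)"
      using dirichlet_integral_holomorphic_pullback[OF D f inj] \<phi>H \<Omega> by (simp add: fD \<psi>_def)
    also have "\<dots> = rayleigh \<Omega> \<phi>" by (simp add: rayleigh_def norm1)
    finally show ?thesis using rayleigh_weak_eigenfunction[OF assms(20)] by simp
  qed
  \<comment> \<open>The normalisation of \<open>\<phi>\<close> becomes a weighted normalisation of \<open>\<psi>\<close>.\<close>
  have w: "integrable ?M (\<lambda>z. (cmod (deriv f z))\<^sup>2 * (\<psi> z)\<^sup>2)"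
    and w1: "(\<integral>z. (cmod (deriv f z))\<^sup>2 * (\<psi> z)\<^sup>2 \<partial>?M) = 1"
    using holomorphic_change_of_variables[OF D(1) f inj, of "\<lambda>w. (\<phi> w)\<^sup>2"] \<phi>2 norm1
    by (simp_all add: fD \<psi>_def square_integrable_on_def)
  have \<psi>m: "\<psi> \<in> borel_measurable ?M"
    using measurable_holomorphic_pullback[OF D(1) f inj, of \<phi>] integrable_inner_square_integrable[OF \<Omega> \<phi>2]
    by (simp add: fD \<psi>_def o_def)
  \<comment> \<open>The weight is bounded below, so the unweighted square is integrable as well.\<close>
  have \<psi>2: "integrable ?M (\<lambda>z. (\<psi> z)\<^sup>2)"
  proof -
    obtain M where M: "M-lipschitz_on (f ` D) (inv_into D f)"
      using assms(5) by (auto simp: bilipschitz_on_def D_def)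
    show ?thesis
    proof (rule Bochner_Integration.integrable_bound)
      show "integrable ?M (\<lambda>z. M\<^sup>2 * ((cmod (deriv f z))\<^sup>2 * (\<psi> z)\<^sup>2))" using w by simp
      show "AE z in ?M. norm ((\<psi> z)\<^sup>2) \<le> norm (M\<^sup>2 * ((cmod (deriv f z))\<^sup>2 * (\<psi> z)\<^sup>2))"
      proof (rule AE_I2)
        fix z assume "z \<in> space ?M"
        then have "1 \<le> M * cmod (deriv f z)"
          using deriv_lower_bound_lipschitz_inverse[OF D(1) f inj M] by simp
        then have "1 \<le> (M * cmod (deriv f z))\<^sup>2" by simp
        then have "1 * (\<psi> z)\<^sup>2 \<le> (M * cmod (deriv f z))\<^sup>2 * (\<psi> z)\<^sup>2" by (intro mult_right_mono) auto
        then show "norm ((\<psi> z)\<^sup>2) \<le> norm (M\<^sup>2 * ((cmod (deriv f z))\<^sup>2 * (\<psi> z)\<^sup>2))"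
          by (simp add: power_mult_distrib abs_mult mult.assoc)
      qed
    qed (use \<psi>m in auto)
  qed
  have not0: "\<not> (AE z in ?M. \<psi> z = 0)"
  proof
    assume "AE z in ?M. \<psi> z = 0"
    then have "AE z in ?M. (cmod (deriv f z))\<^sup>2 * (\<psi> z)\<^sup>2 = 0" by eventually_elim simp
    from integral_eq_zero_AE[OF this] w1 show False by simp
  qed
  then have "(\<integral>z. (\<psi> z)\<^sup>2 \<partial>?M) \<noteq> 0"
    using integral_nonneg_eq_0_iff_AE[OF \<psi>2] by simp
  moreover have "0 \<le> (\<integral>z. (\<psi> z)\<^sup>2 \<partial>?M)" by simp
  ultimately have pos: "0 < (\<integral>z. (\<psi> z)\<^sup>2 \<partial>?M)" by linarith
  have first: "is_first_eigenvalue D ((\<lambda>v. v \<circ> f) ` ?V) lamD" using assms(19) by (simp add: D_def)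
  have "lamD \<le> rayleigh D \<psi>"
    using first not0 \<phi>V unfolding is_first_eigenvalue_def \<psi>_def by blast
  then have upper: "lamD * (\<integral>z. (\<psi> z)\<^sup>2 \<partial>?M) \<le> lam\<Omega>"
    using pos by (simp add: rayleigh_def energy field_simps)
  have "0 \<le> lamD"
  proof -
    obtain v where "weak_eigenfunction D ((\<lambda>v. v \<circ> f) ` ?V) lamD v"
      using first unfolding is_first_eigenvalue_def by blast
    from rayleigh_weak_eigenfunction[OF this] show ?thesis
      by (auto simp: rayleigh_def)
  qed
  moreover have "2 * (\<integral>z. (\<psi> z)\<^sup>2 * Re (deriv f z) \<partial>?M) - 1 \<le> (\<integral>z. (\<psi> z)\<^sup>2 \<partial>?M)"
  proof -
    have pt: "2 * \<bar>Re c\<bar> \<le> 1 + (cmod c)\<^sup>2" for c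
    proof -
      have "0 \<le> (1 - \<bar>Re c\<bar>)\<^sup>2 + (Im c)\<^sup>2" by simp
      then show ?thesis by (simp add: cmod_power2 power2_diff)
    qed
    have i: "integrable ?M (\<lambda>z. (\<psi> z)\<^sup>2 * Re (deriv f z))"
    proof (rule Bochner_Integration.integrable_bound)
      show "integrable ?M (\<lambda>z. (\<psi> z)\<^sup>2 + (cmod (deriv f z))\<^sup>2 * (\<psi> z)\<^sup>2)" using \<psi>2 w by simp
      have "continuous_on D (\<lambda>z. Re (deriv f z))"
        by (intro continuous_intros holomorphic_on_imp_continuous_on holomorphic_deriv f D)
      then have "(\<lambda>z. Re (deriv f z)) \<in> borel_measurable ?M"
        using D by (intro continuous_imp_measurable_on_sets_lebesgue) auto
      then show "(\<lambda>z. (\<psi> z)\<^sup>2 * Re (deriv f z)) \<in> borel_measurable ?M"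
        using \<psi>m by (intro borel_measurable_times borel_measurable_power)
      show "AE z in ?M. norm ((\<psi> z)\<^sup>2 * Re (deriv f z)) \<le> norm ((\<psi> z)\<^sup>2 + (cmod (deriv f z))\<^sup>2 * (\<psi> z)\<^sup>2)"
      proof (rule AE_I2)
        fix z
        have "\<bar>Re (deriv f z)\<bar> \<le> 1 + (cmod (deriv f z))\<^sup>2" using pt[of "deriv f z"] by linarith
        then have "(\<psi> z)\<^sup>2 * \<bar>Re (deriv f z)\<bar> \<le> (\<psi> z)\<^sup>2 * (1 + (cmod (deriv f z))\<^sup>2)"
          by (intro mult_left_mono) auto
        then show "norm ((\<psi> z)\<^sup>2 * Re (deriv f z)) \<le> norm ((\<psi> z)\<^sup>2 + (cmod (deriv f z))\<^sup>2 * (\<psi> z)\<^sup>2)"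
          by (simp add: abs_mult algebra_simps)
      qed
    qed
    have "(\<integral>z. 2 * ((\<psi> z)\<^sup>2 * Re (deriv f z)) \<partial>?M) \<le> (\<integral>z. (\<psi> z)\<^sup>2 + (cmod (deriv f z))\<^sup>2 * (\<psi> z)\<^sup>2 \<partial>?M)"
    proof (rule integral_mono)
      fix z
      have "2 * Re (deriv f z) \<le> 1 + (cmod (deriv f z))\<^sup>2" using pt[of "deriv f z"] by linarith
      then have "(\<psi> z)\<^sup>2 * (2 * Re (deriv f z)) \<le> (\<psi> z)\<^sup>2 * (1 + (cmod (deriv f z))\<^sup>2)"
        by (intro mult_left_mono) auto
      then show "2 * ((\<psi> z)\<^sup>2 * Re (deriv f z)) \<le> (\<psi> z)\<^sup>2 + (cmod (deriv f z))\<^sup>2 * (\<psi> z)\<^sup>2"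
        by (simp add: algebra_simps)
    qed (use i \<psi>2 w in simp_all)
    then show ?thesis using \<psi>2 w w1 by simp
  qed
  ultimately have "lamD * (2 * (\<integral>z. (\<psi> z)\<^sup>2 * Re (deriv f z) \<partial>?M) - 1) \<le> lamD * (\<integral>z. (\<psi> z)\<^sup>2 \<partial>?M)"
    by (rule mult_left_mono[rotated])
  with upper show ?thesis by (simp add: \<psi>_def D_def)
qed

end
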